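(* For an odd positive integer $n$ let $a_n=(-1)^{(n-1)/2}$, and for an odd positive integer $n=p_1^{r_1}\cdots p_k^{r_k}$ (distinct odd primes $p_i$, $r_i\ge 1$; $n=1$ being the empty product) let $$\alpha_n=\prod_{i=1}^k (-1)^{r_i}(-1)^{\frac{p_i^{r_i}-1}{2}} .$$ Define $$\zeta(M,s)=\sum_{k=1}^\infty \frac{a_{2k-1}}{(2k-1)^s}=\sum_{k=1}^\infty \frac{(-1)^{k-1}}{(2k-1)^s},\qquad \hat\zeta(M,s)=\sum_{k=1}^\infty \frac{\alpha_{2k-1}}{(2k-1)^s}.$$ Then for every complex $s$ with $\operatorname{Re}(s)>1$, $$\zeta(M,s)\cdot\hat\zeta(M,s)=\sum_{k=1}^\infty \frac{1}{(2k-1)^{2s}} .$$ Moreover, at $s=1$ (with the series summed in order of increasing $k$), $$\sum_{k=1}^\infty \frac{(-1)^{k-1}}{2k-1}\cdot \sum_{k=1}^\infty \frac{\alpha_{2k-1}}{2k-1}=\sum_{k=1}^\infty\frac{1}{(2k-1)^2}.$$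
   Context: The numbers $a_p$ arise as error terms in counting points on the affine curve $x^2+y^2=1$ over $\mathbb{F}_p$ ($p$ odd prime). One has $\alpha_{p^k}=(-1)^k a_{p^k}$, the maps $n\mapsto a_n$ and $n\mapsto\alpha_n$ are multiplicative on odd integers, and $\alpha_n=(-1)^{r_1+\cdots+r_k}a_n$. *)

theory Defs
  imports "HOL-Analysis.Analysis" "HOL-Computational_Algebra.Primes"
begin

text \<open>Both sequences are only meant for odd arguments; even ones are never used.\<close>

definition a_seq :: "nat \<Rightarrow> int" where
  "a_seq n = (-1) ^ ((n - 1) div 2)"

definition alpha_seq :: "nat \<Rightarrow> int" where
  "alpha_seq n = (\<Prod>p\<in>prime_factors n.
     (-1) ^ multiplicity p n * (-1) ^ ((p ^ multiplicity p n - 1) div 2))"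

text \<open>The series over \<open>k \<ge> 1\<close> with denominators \<open>2k - 1\<close> are indexed here
  from \<open>k = 0\<close> with denominators \<open>2k + 1\<close>.\<close>

definition zeta_M :: "complex \<Rightarrow> complex" where
  "zeta_M s = (\<Sum>k. of_int (a_seq (2 * k + 1)) / of_nat (2 * k + 1) powr s)"

definition zeta_hat_M :: "complex \<Rightarrow> complex" where
  "zeta_hat_M s = (\<Sum>k. of_int (alpha_seq (2 * k + 1)) / of_nat (2 * k + 1) powr s)"

end

theory Submission
  imports Defs "HOL-Complex_Analysis.Complex_Analysis" "HOL-Real_Asymp.Real_Asymp"
begin

text \<open>The sequence \<open>a\<close> is the nontrivial character modulo \<open>4\<close> and \<open>\<alpha> = \<lambda> a\<close> with Liouville's function \<open>\<lambda>\<close>.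
  Since \<open>\<Sum>d|n. \<lambda> d\<close> is the indicator of the squares and \<open>a\<close> is completely multiplicative with
  \<open>a\<^sup>2 = 1\<close>, the Dirichlet product of the two series is supported on the odd squares, which settles
  \<open>Re s > 1\<close>. At \<open>s = 1\<close> the convergence of the second series is as deep as the prime number
  theorem for arithmetic progressions modulo \<open>4\<close>: its sum for \<open>Re s > 1\<close> is \<open>\<zeta>\<^sub>o (2 s) / L s\<close>, where \<open>\<zeta>\<^sub>o\<close> is
  the zeta series over odd numbers and \<open>L\<close> the series of \<open>a\<close>. The function \<open>L\<close> has no zero on \<open>Re s = 1\<close>
  (Ramanujan's identity and Landau's positivity argument), so the quotient is holomorphic around the
  closed half-plane \<open>Re s \<ge> 1\<close>, and Newman's contour argument gives convergence to its value at \<open>1\<close>.\<close>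

section \<open>Completely multiplicative sequences on the odd numbers\<close>

text \<open>At \<open>s = 1\<close> the second series converges only conditionally and its signs do
  not alternate, so the two series are never multiplied there: the identity is read off from the
  value of the quotient once convergence is known. What Newman's theorem asks for is bounded
  coefficients and holomorphy slightly past the line \<open>Re s = 1\<close>. For the zeros on that
  line, the usual 3-4-1 inequality breaks down at the real point, because the square of
  \<open>a\<close> is principal and its pole offsets the zero. Ramanujan's identity with the twist
  \<open>u n = a_n n^(-i t)\<close> treats \<open>t = 0\<close> and \<open>t \<noteq> 0\<close>
  alike. The contradiction then appears at \<open>s = 1/2\<close>, which is why \<open>L_chi\<close>
  and \<open>Z_odd\<close> are continued to all of \<open>Re s > 0\<close>. Dividing by
  \<open>zeta_odd (2 s)\<close> requires that it has no zeros; this follows from the same Liouville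
  convolution, applied to the coefficients \<open>1\<close> instead of \<open>a\<close>.\<close>

definition liouville :: "nat \<Rightarrow> int" where
  "liouville n = (-1) ^ size (prime_factorization n)"

lemma liouville_1 [simp]: "liouville (Suc 0) = 1"
  by (simp add: liouville_def)

lemma liouville_prime_mult: "prime p \<Longrightarrow> n > 0 \<Longrightarrow> liouville (p * n) = - liouville n"
  by (simp add: liouville_def prime_factorization_mult prime_factorization_prime)

text \<open>The divisors of \<open>p * m\<close> are those of \<open>m\<close> and their multiples
  by \<open>p\<close>. Multiplication by \<open>p\<close> flips the sign, so the two sums cancel and
  inclusion-exclusion leaves minus the overlap, which is empty or \<open>p\<close> times the
  divisors of \<open>m div p\<close>.\<close>

lemma sum_liouville_prime_mult:
  assumes p: "prime p" and m: "m > 0"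
  shows "(\<Sum>d | d dvd p * m. liouville d) =
    (if p dvd m then (\<Sum>d | d dvd m div p. liouville d) else 0)"
proof -
  let ?D = "\<lambda>n::nat. {d. d dvd n}"
  have p0: "p > 0" using p prime_gt_0_nat by blast
  have fin: "finite (?D n)" if "n > 0" for n using that by simp
  have scale: "(\<Sum>d\<in>(*) p ` ?D n. liouville d) = - (\<Sum>d\<in>?D n. liouville d)" if "n > 0" for n
  proof -
    have "(\<Sum>d\<in>(*) p ` ?D n. liouville d) = (\<Sum>d\<in>?D n. liouville (p * d))"
      using p0 by (subst sum.reindex) (auto simp: inj_on_def)
    also have "\<dots> = (\<Sum>d\<in>?D n. - liouville d)"
      using that p by (intro sum.cong) (auto intro!: liouville_prime_mult dvd_pos_nat[of n])
    finally show ?thesis by (simp add: sum_negf)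
  qed
  have un: "?D (p * m) = ?D m \<union> (*) p ` ?D m"
  proof (intro equalityI subsetI)
    fix d assume "d \<in> ?D (p * m)"
    hence d: "d dvd p * m" by simp
    show "d \<in> ?D m \<union> (*) p ` ?D m"
    proof (cases "p dvd d")
      case True
      then obtain e where "d = p * e" by blast
      with d p0 show ?thesis by auto
    next
      case False
      hence "coprime d p" using p prime_imp_coprime coprime_commute by blast
      with d show ?thesis by (simp add: coprime_dvd_mult_right_iff)
    qed
  qed auto
  have "(\<Sum>d\<in>?D (p * m). liouville d) =
      (\<Sum>d\<in>?D m. liouville d) + (\<Sum>d\<in>(*) p ` ?D m. liouville d)
      - (\<Sum>d\<in>?D m \<inter> (*) p ` ?D m. liouville d)"
    unfolding un using fin[OF m] by (simp add: sum_Un)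
  also have "\<dots> = - (\<Sum>d\<in>?D m \<inter> (*) p ` ?D m. liouville d)"
    using scale[OF m] by simp
  also have "\<dots> = (if p dvd m then (\<Sum>d\<in>?D (m div p). liouville d) else 0)"
  proof (cases "p dvd m")
    case True
    then obtain k where k: "m = p * k" by blast
    hence k0: "k > 0" using m by auto
    have "?D m \<inter> (*) p ` ?D m = (*) p ` ?D k"
      unfolding k using p0 by auto
    thus ?thesis using True k p0 scale[OF k0] by simp
  next
    case False
    hence "?D m \<inter> (*) p ` ?D m = {}" by (auto dest: dvd_mult_left)
    thus ?thesis using False by simp
  qed
  finally show ?thesis by simp
qed

text \<open>Strip a factor \<open>p ^ 2\<close>, which changes neither the sum nor squareness. If a
  prime divides \<open>n\<close> exactly once, then \<open>n\<close> is no square and the sum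
  vanishes.\<close>

lemma sum_liouville_divisors:
  assumes "n > 0"
  shows "(\<Sum>d | d dvd n. liouville d) = (if \<exists>k. n = k ^ 2 then 1 else 0)"
  using assms
proof (induction n rule: less_induct)
  case (less n)
  show ?case
  proof (cases "n = 1")
    case True
    have "\<exists>k::nat. Suc 0 = k ^ 2" by (rule exI[of _ 1]) simp
    with True show ?thesis by simp
  next
    case False
    then obtain p where p: "prime p" "p dvd n" using prime_factor_nat by blast
    then obtain m where n: "n = p * m" by blast
    have m: "m > 0" and p0: "p > 0" using less.prems n by auto
    show ?thesis
    proof (cases "p dvd m")
      case True
      then obtain k where k: "m = p * k" by blast
      have k0: "k > 0" using m k by auto
      moreover have "1 < p * p" using prime_gt_1_nat[OF p(1)] by (rule less_1_mult) (rule prime_gt_1_nat[OF p(1)])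
      ultimately have kn: "k < n" using n k by (simp flip: mult.assoc)
      have "(\<exists>j. n = j ^ 2) \<longleftrightarrow> (\<exists>j. k = j ^ 2)"
      proof
        assume "\<exists>j. k = j ^ 2"
        thus "\<exists>j. n = j ^ 2" using n k by (metis mult.assoc power2_eq_square power_mult_distrib)
      next
        assume "\<exists>j. n = j ^ 2"
        then obtain j where j: "n = j ^ 2" by blast
        hence "p dvd j" using p prime_dvd_power by blast
        then obtain i where "j = p * i" by blast
        hence "k = i ^ 2" using j n k p0 by (simp add: power2_eq_square)
        thus "\<exists>j. k = j ^ 2" by blast
      qed
      thus ?thesis using less.IH[OF kn k0] sum_liouville_prime_mult[OF p(1) m] True n k p0
        by simp
    next
      case False
      have "\<not> (\<exists>j. n = j ^ 2)"
      proof
        assume "\<exists>j. n = j ^ 2"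
        then obtain j where j: "n = j ^ 2" by blast
        hence "p dvd j" using p prime_dvd_power by blast
        then obtain i where "j = p * i" by blast
        hence "m = p * i ^ 2" using j n p0 by (simp add: power2_eq_square)
        thus False using False by simp
      qed
      thus ?thesis using sum_liouville_prime_mult[OF p(1) m] False n by simp
    qed
  qed
qed

section \<open>Dirichlet products over the odd numbers, as unordered absolutely convergent
  sums\<close>

lemma summable_norm_times:
  fixes f :: "'a \<Rightarrow> complex" and g :: "'b \<Rightarrow> complex"
  assumes f: "(\<lambda>x. norm (f x)) summable_on A" and g: "(\<lambda>x. norm (g x)) summable_on B"
  shows "(\<lambda>z. norm (case z of (x, y) \<Rightarrow> f x * g y)) summable_on (A \<times> B)"
proof -
  have "(\<lambda>y. norm (f x * g y)) summable_on B" for x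
    using g by (simp add: norm_mult summable_on_cmult_right)
  moreover have "(\<lambda>x. norm (\<Sum>\<^sub>\<infinity>y\<in>B. norm (f x * g y))) summable_on A"
  proof -
    have "(\<Sum>\<^sub>\<infinity>y\<in>B. norm (f x * g y)) = norm (f x) * (\<Sum>\<^sub>\<infinity>y\<in>B. norm (g y))" for x
      using g by (simp add: norm_mult infsum_cmult_right)
    thus ?thesis using f by (simp add: abs_mult summable_on_cmult_left infsum_nonneg)
  qed
  ultimately show ?thesis
    using Infinite_Sum.abs_summable_on_Sigma_iff[of "\<lambda>(x, y). f x * g y" A "\<lambda>_. B"] by simp
qed

lemma has_sum_times:
  fixes f :: "'a \<Rightarrow> complex" and g :: "'b \<Rightarrow> complex"
  assumes f: "(\<lambda>x. norm (f x)) summable_on A" and g: "(\<lambda>x. norm (g x)) summable_on B"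
  shows "((\<lambda>(x, y). f x * g y) has_sum (infsum f A * infsum g B)) (A \<times> B)"
proof (rule has_sum_SigmaI[where g = "\<lambda>x. f x * infsum g B"])
  show "((\<lambda>y. case (x, y) of (x, y) \<Rightarrow> f x * g y) has_sum f x * infsum g B) B" for x
    using has_sum_cmult_right[OF has_sum_infsum[OF abs_summable_summable[OF g]], of "f x"] by simp
  show "((\<lambda>x. f x * infsum g B) has_sum infsum f A * infsum g B) A"
    by (rule has_sum_cmult_left[OF has_sum_infsum[OF abs_summable_summable[OF f]]])
  show "(\<lambda>(x, y). f x * g y) summable_on A \<times> B"
    by (rule abs_summable_summable[OF summable_norm_times[OF f g]])
qed

definition odds :: "nat set" where "odds = {n. odd n}"

lemma odds_pos: "n \<in> odds \<Longrightarrow> n > 0"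
  by (auto simp: odds_def intro: odd_pos)

lemma mult_in_odds: "m \<in> odds \<Longrightarrow> n \<in> odds \<Longrightarrow> m * n \<in> odds"
  by (simp add: odds_def)

lemma dvd_odds: "n \<in> odds \<Longrightarrow> d dvd n \<Longrightarrow> d \<in> odds"
  by (auto simp: odds_def elim: dvdE)

text \<open>Absolute convergence lets the pairs \<open>(d, e)\<close> be regrouped by their product
  \<open>n = d * e\<close>.\<close>

lemma has_sum_dirichlet_prod:
  fixes f g :: "nat \<Rightarrow> complex"
  assumes f: "(\<lambda>x. norm (f x)) summable_on odds" and g: "(\<lambda>x. norm (g x)) summable_on odds"
  shows "((\<lambda>n. \<Sum>d | d dvd n. f d * g (n div d)) has_sum (infsum f odds * infsum g odds)) odds"
proof -
  have "((\<lambda>(n, d). f d * g (n div d)) has_sum (infsum f odds * infsum g odds))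
      (Sigma odds (\<lambda>n. {d. d dvd n}))"
    using has_sum_times[OF f g]
  proof (rule iffD1[OF has_sum_reindex_bij_witness[where
        i = "\<lambda>(n, d). (d, n div d)" and j = "\<lambda>(d, e). (d * e, d)"], rotated -1])
  qed (auto simp: odds_pos dvd_odds mult_in_odds)
  thus ?thesis
  proof (rule has_sum_SigmaD)
    fix n assume n: "n \<in> odds"
    hence "finite {d. d dvd n}" using odds_pos by simp
    from has_sum_finite[OF this, of "\<lambda>d. f d * g (n div d)"]
    show "((\<lambda>d. case (n, d) of (n, d) \<Rightarrow> f d * g (n div d)) has_sum
        (\<Sum>d | d dvd n. f d * g (n div d))) {d. d dvd n}" by simp
  qed
qed

lemma summable_norm_unimodular_mult:
  fixes f g :: "'a \<Rightarrow> complex"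
  assumes "(\<lambda>x. norm (f x)) summable_on A" "\<And>x. x \<in> A \<Longrightarrow> norm (g x) = 1"
  shows "(\<lambda>x. norm (g x * f x)) summable_on A"
  using assms by (simp add: norm_mult cong: summable_on_cong)

lemma abs_liouville [simp]: "\<bar>real_of_int (liouville n)\<bar> = 1"
  by (simp add: liouville_def power_abs)

text \<open>Complete multiplicativity pulls \<open>f n\<close> out of the divisor sum, and what
  remains is the indicator of the squares. With \<open>f n = n^(-s)\<close> this gives the doubling
  relation for \<open>zeta_odd\<close>, with \<open>f n = a_n n^(-s)\<close> the product formula of
  the theorem.\<close>

lemma liouville_convolution:
  fixes f :: "nat \<Rightarrow> complex"
  assumes f: "(\<lambda>x. norm (f x)) summable_on odds"
    and mult: "\<And>m n. m \<in> odds \<Longrightarrow> n \<in> odds \<Longrightarrow> f (m * n) = f m * f n"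
  shows "((\<lambda>k. f (k ^ 2)) has_sum
      (infsum f odds * (\<Sum>\<^sub>\<infinity>n\<in>odds. of_int (liouville n) * f n))) odds"
proof -
  have "((\<lambda>n. \<Sum>d | d dvd n. (of_int (liouville d) * f d) * f (n div d)) has_sum
      ((\<Sum>\<^sub>\<infinity>n\<in>odds. of_int (liouville n) * f n) * infsum f odds)) odds"
    by (intro has_sum_dirichlet_prod f summable_norm_unimodular_mult) simp_all
  also have "?this \<longleftrightarrow> ((\<lambda>n. if n \<in> (\<lambda>k. k ^ 2) ` odds then f n else 0) has_sum
      ((\<Sum>\<^sub>\<infinity>n\<in>odds. of_int (liouville n) * f n) * infsum f odds)) odds"
  proof (rule has_sum_cong)
    fix n assume n: "n \<in> odds"
    have "(\<Sum>d | d dvd n. (of_int (liouville d) * f d) * f (n div d)) =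
        (\<Sum>d | d dvd n. of_int (liouville d) * f n)"
    proof (intro sum.cong refl)
      fix d assume "d \<in> {d. d dvd n}"
      then obtain e where e: "n = d * e" by auto
      have "d \<in> odds" "e \<in> odds" using n e by (auto simp: odds_def)
      thus "of_int (liouville d) * f d * f (n div d) = of_int (liouville d) * f n"
        using e mult odds_pos by simp
    qed
    also have "\<dots> = of_int (\<Sum>d | d dvd n. liouville d) * f n"
      by (simp add: sum_distrib_right)
    also have "\<dots> = (if n \<in> (\<lambda>k. k ^ 2) ` odds then f n else 0)"
      using n by (subst sum_liouville_divisors) (auto simp: odds_pos, auto simp: odds_def)
    finally show "(\<Sum>d | d dvd n. (of_int (liouville d) * f d) * f (n div d)) = \<dots>" .
  qed
  also have "\<dots> \<longleftrightarrow> (f has_sum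
      ((\<Sum>\<^sub>\<infinity>n\<in>odds. of_int (liouville n) * f n) * infsum f odds)) ((\<lambda>k. k ^ 2) ` odds)"
    by (rule has_sum_cong_neutral) (auto simp: odds_def)
  also have "\<dots> \<longleftrightarrow> ((\<lambda>k. f (k ^ 2)) has_sum
      ((\<Sum>\<^sub>\<infinity>n\<in>odds. of_int (liouville n) * f n) * infsum f odds)) odds"
    by (subst has_sum_reindex) (auto simp: inj_on_def o_def)
  finally show ?thesis by (simp add: mult.commute)
qed

section \<open>The character modulo 4 and its Liouville twist\<close>

lemma a_seq_mult: "odd m \<Longrightarrow> odd n \<Longrightarrow> a_seq (m * n) = a_seq m * a_seq n"
proof -
  assume "odd m" "odd n"
  then obtain a b where ab: "m = 2 * a + 1" "n = 2 * b + 1" by (auto elim!: oddE)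
  have "(m * n - 1) div 2 = 2 * (a * b) + (a + b)" unfolding ab by (simp add: algebra_simps)
  thus ?thesis unfolding a_seq_def by (simp add: ab power_add power_mult)
qed

lemma a_seq_1 [simp]: "a_seq (Suc 0) = 1"
  by (simp add: a_seq_def)

lemma a_seq_prod: "finite S \<Longrightarrow> (\<And>x. x \<in> S \<Longrightarrow> odd (g x)) \<Longrightarrow>
    odd (prod g S) \<and> a_seq (prod g S) = (\<Prod>x\<in>S. a_seq (g x))"
  by (induction S rule: finite_induct) (auto simp: a_seq_mult)

lemma abs_a_seq [simp]: "\<bar>real_of_int (a_seq n)\<bar> = 1"
  by (simp add: a_seq_def power_abs)

lemma alpha_seq_eq:
  assumes "odd n"
  shows "alpha_seq n = liouville n * a_seq n"
proof -
  have n: "n > 0" using assms odd_pos by blast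
  let ?P = "prime_factors n"
  have odd: "odd (p ^ multiplicity p n)" if "p \<in> ?P" for p
    using assms that by (metis dvd_trans even_power prime_factors_dvd in_prime_factors_iff)
  have "alpha_seq n = (\<Prod>p\<in>?P. (-1) ^ multiplicity p n) * (\<Prod>p\<in>?P. a_seq (p ^ multiplicity p n))"
    by (simp add: alpha_seq_def a_seq_def prod.distrib)
  also have "(\<Prod>p\<in>?P. (-1) ^ multiplicity p n) = liouville n"
    unfolding liouville_def size_multiset_overloaded_eq
    by (subst power_sum) (auto intro!: prod.cong simp: count_prime_factorization)
  also have "(\<Prod>p\<in>?P. a_seq (p ^ multiplicity p n)) = a_seq (\<Prod>p\<in>?P. p ^ multiplicity p n)"
    using a_seq_prod[of ?P "\<lambda>p. p ^ multiplicity p n"] odd by simp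
  also have "(\<Prod>p\<in>?P. p ^ multiplicity p n) = n"
    using prod_prime_factors[of n] n by simp
  finally show ?thesis .
qed

section \<open>Ramanujan's formula\<close>

definition coprime_odds :: "(nat \<times> nat) set" where
  "coprime_odds = {(d, e). d \<in> odds \<and> e \<in> odds \<and> coprime d e}"

lemma coprime_pair_of_gcd:
  fixes a b :: nat
  assumes "a > 0"
  obtains k d e where "k = gcd a b" "a = k * d" "b = k * e" "coprime d e" "k > 0"
  using gcd_coprime_exists[of a b] assms by (metis gcd_pos_nat mult.commute neq0_conv gcd_eq_0_iff)

lemma squares_summable_on_odds:
  fixes f :: "nat \<Rightarrow> complex"
  assumes "(\<lambda>n. norm (f n)) summable_on odds"
  shows "(\<lambda>k. norm (f (k ^ 2))) summable_on odds"
proof -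
  have "(\<lambda>n. norm (f n)) summable_on ((\<lambda>k. k ^ 2) ` odds)"
    by (rule summable_on_subset_banach[OF assms]) (auto simp: odds_def)
  thus ?thesis by (subst (asm) summable_on_reindex) (auto simp: inj_on_def o_def)
qed

text \<open>The sum \<open>V\<close> over coprime pairs occurs on both sides: dividing a pair of odd numbers by its greatest common divisor gives
  \<open>(\<Sum>u f) (\<Sum>cnj u f) = (\<Sum>f (k\<^sup>2)) V\<close>, and writing the triples \<open>(n, a, b)\<close> with \<open>a\<close> and \<open>b\<close> dividing \<open>n\<close>
  as \<open>n = m k d e\<close>, \<open>a = k d\<close>, \<open>b = k e\<close> gives the left-hand side as \<open>(\<Sum>f)\<^sup>2 V\<close>.\<close>

lemma ramanujan_convolution:
  fixes f u :: "nat \<Rightarrow> complex"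
  assumes f: "(\<lambda>n. norm (f n)) summable_on odds"
    and f_mult: "\<And>m n. m \<in> odds \<Longrightarrow> n \<in> odds \<Longrightarrow> f (m * n) = f m * f n"
    and u_mult: "\<And>m n. m \<in> odds \<Longrightarrow> n \<in> odds \<Longrightarrow> u (m * n) = u m * u n"
    and u_norm: "\<And>n. n \<in> odds \<Longrightarrow> norm (u n) = 1"
  obtains B where "((\<lambda>n. of_real (norm (\<Sum>d | d dvd n. u d) ^ 2) * f n) has_sum B) odds"
    and "B * (\<Sum>\<^sub>\<infinity>k\<in>odds. f (k ^ 2)) =
      (infsum f odds) ^ 2 * (\<Sum>\<^sub>\<infinity>n\<in>odds. u n * f n) * (\<Sum>\<^sub>\<infinity>n\<in>odds. cnj (u n) * f n)"
proof -
  define q where "q = (\<lambda>(d, e). u d * f d * (cnj (u e) * f e))"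
  define V where "V = infsum q coprime_odds"
  \<comment> \<open>Because \<open>u\<close> is unimodular, a common factor \<open>k\<close> of
    \<open>a\<close> and \<open>b\<close> contributes \<open>u k * cnj (u k) = 1\<close>, which is
    how it disappears from both regroupings below.\<close>
  have uu: "u n * cnj (u n) = 1" if "n \<in> odds" for n
    using u_norm[OF that] by (metis complex_norm_square mult_1 of_real_1 power_one)
  have uf: "(\<lambda>n. norm (u n * f n)) summable_on odds"
    and uf': "(\<lambda>n. norm (cnj (u n) * f n)) summable_on odds"
    using f u_norm by (auto intro!: summable_norm_unimodular_mult)
  have sub: "coprime_odds \<subseteq> odds \<times> odds" by (auto simp: coprime_odds_def)
  have q: "(\<lambda>z. norm (q z)) summable_on coprime_odds"
    unfolding q_def by (rule summable_on_subset_banach[OF summable_norm_times[OF uf uf'] sub])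
  have f2: "(\<lambda>k. norm (f (k ^ 2))) summable_on odds"
    by (rule squares_summable_on_odds[OF f])
  have "((\<lambda>(k, z). f (k ^ 2) * q z) has_sum
      ((\<Sum>\<^sub>\<infinity>n\<in>odds. u n * f n) * (\<Sum>\<^sub>\<infinity>n\<in>odds. cnj (u n) * f n))) (odds \<times> coprime_odds)"
    using has_sum_times[OF uf uf']
  proof (rule iffD1[OF has_sum_reindex_bij_witness[where
        i = "\<lambda>(k, d, e). (k * d, k * e)" and
        j = "\<lambda>(a, b). (gcd a b, a div gcd a b, b div gcd a b)"], rotated -1])
    fix z assume "z \<in> odds \<times> odds"
    then obtain a b where z: "z = (a, b)" "a \<in> odds" "b \<in> odds" by auto
    obtain k d e where k: "k = gcd a b" and ab: "a = k * d" "b = k * e" "coprime d e" "k > 0"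
      using odds_pos[OF z(2)] by (rule coprime_pair_of_gcd)
    have o: "k \<in> odds" "d \<in> odds" "e \<in> odds" using z ab by (auto simp: odds_def)
    have dv: "a div k = d" "b div k = e" using ab by auto
    have g: "gcd (k * d) (k * e) = k" using k ab by simp
    show "(case case z of (a, b) \<Rightarrow> (gcd a b, a div gcd a b, b div gcd a b) of
        (k, d, e) \<Rightarrow> (k * d, k * e)) = z"
      using z ab by (simp add: k[symmetric] dv)
    show "(case z of (a, b) \<Rightarrow> (gcd a b, a div gcd a b, b div gcd a b)) \<in> odds \<times> coprime_odds"
      using z ab o by (simp add: g coprime_odds_def)
    have "f (k ^ 2) * (u d * f d * (cnj (u e) * f e)) =
        (u k * cnj (u k)) * (f k * f k * (u d * f d * (cnj (u e) * f e)))"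
      using o by (simp add: uu power2_eq_square f_mult)
    also have "\<dots> = u a * f a * (cnj (u b) * f b)"
      using o by (simp add: ab f_mult u_mult algebra_simps)
    finally show "(case case z of (a, b) \<Rightarrow> (gcd a b, a div gcd a b, b div gcd a b) of
        (k, z) \<Rightarrow> f (k ^ 2) * q z) = (case z of (x, y) \<Rightarrow> u x * f x * (cnj (u y) * f y))"
      using z by (simp add: k[symmetric] dv q_def)
  next
    fix z assume "z \<in> odds \<times> coprime_odds"
    then obtain k d e where z: "z = (k, d, e)" "k \<in> odds" "d \<in> odds" "e \<in> odds" "coprime d e"
      by (auto simp: coprime_odds_def)
    have "gcd (k * d) (k * e) = k" using z by (simp add: gcd_mult_distrib_nat[symmetric])
    thus "(case case z of (k, d, e) \<Rightarrow> (k * d, k * e) of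
        (a, b) \<Rightarrow> (gcd a b, a div gcd a b, b div gcd a b)) = z"
      using z odds_pos[of k] by simp
    show "(case z of (k, d, e) \<Rightarrow> (k * d, k * e)) \<in> odds \<times> odds"
      using z by (simp add: mult_in_odds)
  qed simp
  from infsumI[OF this] infsumI[OF has_sum_times[OF f2 q]]
  have V: "(\<Sum>\<^sub>\<infinity>n\<in>odds. u n * f n) * (\<Sum>\<^sub>\<infinity>n\<in>odds. cnj (u n) * f n) =
      (\<Sum>\<^sub>\<infinity>k\<in>odds. f (k ^ 2)) * V"
    by (simp add: V_def)

  have fq: "(\<lambda>y. norm (case y of (k, z) \<Rightarrow> f k * q z)) summable_on odds \<times> coprime_odds"
    by (rule summable_norm_times[OF f q])
  have "((\<lambda>(m, y). f m * (case y of (k, z) \<Rightarrow> f k * q z)) has_sum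
      (infsum f odds * (infsum f odds * V))) (odds \<times> (odds \<times> coprime_odds))"
    using has_sum_times[OF f fq] infsumI[OF has_sum_times[OF f q]] by (simp add: V_def)
  hence "((\<lambda>(n, a, b). u a * cnj (u b) * f n) has_sum (infsum f odds * (infsum f odds * V)))
      (Sigma odds (\<lambda>n. {a. a dvd n} \<times> {b. b dvd n}))"
  proof (rule iffD2[OF has_sum_reindex_bij_witness[where
        j = "\<lambda>(n, a, b). (n div (a div gcd a b * b), gcd a b, a div gcd a b, b div gcd a b)" and
        i = "\<lambda>(m, k, d, e). (m * k * d * e, k * d, k * e)"], rotated -1])
    fix z assume "z \<in> Sigma odds (\<lambda>n. {a. a dvd n} \<times> {b. b dvd n})"
    then obtain n a b where z: "z = (n, a, b)" "n \<in> odds" "a dvd n" "b dvd n" by auto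
    have ab_odds: "a \<in> odds" "b \<in> odds" using z dvd_odds by auto
    obtain k d e where k: "k = gcd a b" and ab: "a = k * d" "b = k * e" "coprime d e" "k > 0"
      using odds_pos[OF ab_odds(1)] by (rule coprime_pair_of_gcd)
    \<comment> \<open>Here \<open>k * d * e\<close> is the least common multiple of \<open>a\<close>
      and \<open>b\<close>, and \<open>m\<close> is the complementary divisor of
      \<open>n\<close>.\<close>
    have "k * d * e dvd n"
    proof -
      obtain n' where n': "n = k * n'" using z ab by (metis dvd_mult_left dvdE)
      hence "d dvd n'" "e dvd n'" using z ab by auto
      thus ?thesis using n' ab(3) by (simp add: divides_mult mult.assoc)
    qed
    then obtain m where n: "n = m * k * d * e" by (metis dvdE mult.assoc mult.commute)
    have o: "k \<in> odds" "d \<in> odds" "e \<in> odds" "m \<in> odds" using z ab n by (auto simp: odds_def)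
    have dv: "a div k = d" "b div k = e" using ab by auto
    have g: "gcd (k * d) (k * e) = k" using k ab by simp
    have "n = m * (d * b)" using n ab by (simp add: mult_ac)
    hence dv': "n div (d * b) = m" using odds_pos[OF o(2)] odds_pos[OF ab_odds(2)] by simp
    have J: "(case z of (n, a, b) \<Rightarrow>
          (n div (a div gcd a b * b), gcd a b, a div gcd a b, b div gcd a b)) = (m, k, d, e)"
      unfolding z(1) prod.case k[symmetric] dv dv' ..
    show "(case case z of (n, a, b) \<Rightarrow>
          (n div (a div gcd a b * b), gcd a b, a div gcd a b, b div gcd a b) of
        (m, k, d, e) \<Rightarrow> (m * k * d * e, k * d, k * e)) = z"
      unfolding J using z(1) ab n by simp
    show "(case z of (n, a, b) \<Rightarrow>
          (n div (a div gcd a b * b), gcd a b, a div gcd a b, b div gcd a b))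
        \<in> odds \<times> odds \<times> coprime_odds"
      unfolding J using ab o by (simp add: coprime_odds_def)
    have "f m * (f k * (u d * f d * (cnj (u e) * f e))) =
        (u k * cnj (u k)) * (f m * (f k * (u d * f d * (cnj (u e) * f e))))"
      using o by (simp add: uu)
    also have "\<dots> = u a * cnj (u b) * f n"
      using o by (simp add: ab n mult_in_odds f_mult u_mult algebra_simps)
    finally show "(case case z of (n, a, b) \<Rightarrow>
          (n div (a div gcd a b * b), gcd a b, a div gcd a b, b div gcd a b) of
        (m, y) \<Rightarrow> f m * (case y of (k, z) \<Rightarrow> f k * q z)) =
        (case z of (n, a, b) \<Rightarrow> u a * cnj (u b) * f n)"
      unfolding J using z(1) by (simp add: q_def)
  next
    fix z assume "z \<in> odds \<times> odds \<times> coprime_odds"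
    then obtain m k d e where z: "z = (m, k, d, e)" "m \<in> odds" "k \<in> odds" "d \<in> odds" "e \<in> odds"
        "coprime d e"
      by (auto simp: coprime_odds_def)
    have g: "gcd (k * d) (k * e) = k" using z by (simp add: gcd_mult_distrib_nat[symmetric])
    have "m * k * d * e = m * (d * (k * e))" by (simp add: mult_ac)
    hence "m * k * d * e div (d * (k * e)) = m"
      using odds_pos[OF z(3)] odds_pos[OF z(4)] odds_pos[OF z(5)] by simp
    thus "(case case z of (m, k, d, e) \<Rightarrow> (m * k * d * e, k * d, k * e) of
        (n, a, b) \<Rightarrow> (n div (a div gcd a b * b), gcd a b, a div gcd a b, b div gcd a b)) = z"
      using z odds_pos[of k] by (simp add: g)
    show "(case z of (m, k, d, e) \<Rightarrow> (m * k * d * e, k * d, k * e))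
        \<in> Sigma odds (\<lambda>n. {a. a dvd n} \<times> {b. b dvd n})"
      using z by (auto simp: mult_in_odds) 
  qed simp
  hence B: "((\<lambda>n. of_real (norm (\<Sum>d | d dvd n. u d) ^ 2) * f n) has_sum
      (infsum f odds * (infsum f odds * V))) odds"
  proof (rule has_sum_SigmaD)
    fix n assume n: "n \<in> odds"
    hence fin: "finite ({a. a dvd n} \<times> {b. b dvd n})" using odds_pos by simp
    have "(\<Sum>z\<in>{a. a dvd n} \<times> {b. b dvd n}. case (n, z) of (n, a, b) \<Rightarrow> u a * cnj (u b) * f n) =
        (\<Sum>a | a dvd n. u a) * cnj (\<Sum>b | b dvd n. u b) * f n"
      unfolding cnj_sum sum_product sum.cartesian_product
      by (subst sum_distrib_right) (simp add: case_prod_unfold)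
    also have "\<dots> = of_real (norm (\<Sum>d | d dvd n. u d) ^ 2) * f n"
      by (simp only: complex_norm_square)
    finally show "((\<lambda>z. case (n, z) of (n, a, b) \<Rightarrow> u a * cnj (u b) * f n) has_sum
        of_real (norm (\<Sum>d | d dvd n. u d) ^ 2) * f n) ({a. a dvd n} \<times> {b. b dvd n})"
      using has_sum_finite[OF fin] by metis
  qed
  show ?thesis
    by (rule that[OF B]) (use V in \<open>simp add: power2_eq_square algebra_simps\<close>)
qed

section \<open>Analytic continuation\<close>

lemma norm_of_nat_powr: "norm (of_nat n powr s :: complex) = real n powr Re s"
  by (subst norm_powr_real_powr) auto

lemma dirichlet_terms_summable:
  assumes "Re s > 1"
  shows "(\<lambda>n. norm (of_nat n powr - s :: complex)) summable_on A"
proof -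
  have "summable (\<lambda>n. norm (of_nat n powr - s :: complex))"
    using assms by (simp add: norm_of_nat_powr summable_real_powr_iff)
  hence "(\<lambda>n. norm (of_nat n powr - s :: complex)) summable_on UNIV"
    by (simp add: summable_on_UNIV_nonneg_real_iff)
  thus ?thesis by (rule summable_on_subset_banach) simp
qed

lemma bij_betw_odds: "bij_betw (\<lambda>k. 2 * k + 1) UNIV odds"
  by (rule bij_betwI[where g = "\<lambda>n. n div 2"]) (auto simp: odds_def elim!: oddE)

lemma odds_sums: "(f has_sum S) odds \<Longrightarrow> (\<lambda>k. f (2 * k + 1)) sums S"
  by (subst (asm) has_sum_reindex_bij_betw[OF bij_betw_odds, symmetric]) (rule has_sum_imp_sums)

lemma of_nat_mult_powr:
  "of_nat (m * n) powr (s::complex) = of_nat m powr s * of_nat n powr s"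
  using powr_times_real[of "of_nat m" "of_nat n" s] by simp

lemma of_nat_square_powr: "of_nat (n ^ 2) powr - s = of_nat n powr - (2 * s :: complex)"
  by (simp only: power2_eq_square of_nat_mult_powr) (simp flip: powr_add)

lemma holomorphic_suminf:
  fixes f :: "nat \<Rightarrow> complex \<Rightarrow> complex"
  assumes S: "open S" and f: "\<And>n. f n holomorphic_on S"
    and bound: "\<And>x. x \<in> S \<Longrightarrow>
      \<exists>d h. 0 < d \<and> summable h \<and> (\<forall>n. \<forall>y\<in>ball x d \<inter> S. norm (f n y) \<le> h n)"
  shows "(\<lambda>s. \<Sum>n. f n s) holomorphic_on S" and "\<And>s. s \<in> S \<Longrightarrow> summable (\<lambda>n. f n s)"
proof -
  obtain g g' where g: "\<And>x. x \<in> S \<Longrightarrow> (\<lambda>n. f n x) sums g x \<and> (g has_field_derivative g' x) (at x)"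
  proof -
    have "\<exists>g g'. \<forall>x\<in>S. ((\<lambda>n. f n x) sums g x) \<and> ((\<lambda>n. deriv (f n) x) sums g' x) \<and>
        (g has_field_derivative g' x) (at x)"
    proof (rule series_and_derivative_comparison_local[OF S])
      show "(f n has_field_derivative deriv (f n) x) (at x)" if "x \<in> S" for n x
        using f S that by (rule holomorphic_derivI)
      show "\<exists>d h. 0 < d \<and> summable h \<and>
          (\<forall>\<^sub>F n in sequentially. \<forall>y\<in>ball x d \<inter> S. norm (f n y) \<le> h n)" if "x \<in> S" for x
        using bound[OF that] by (blast intro: always_eventually)
    qed
    thus ?thesis using that by blast
  qed
  show "summable (\<lambda>n. f n s)" if "s \<in> S" for s
    using g[OF that] sums_summable by blast
  have "g holomorphic_on S" using g S by (auto simp: holomorphic_on_open)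
  thus "(\<lambda>s. \<Sum>n. f n s) holomorphic_on S"
    by (rule holomorphic_transform) (use g in \<open>auto simp: sums_iff\<close>)
qed

section \<open>Term estimates that gain one power and so reach \<open>Re s > 0\<close>\<close>

lemma norm_powr_le:
  assumes "0 < x" "x \<le> y" "Re s \<ge> 0"
  shows "norm (complex_of_real y powr - s) \<le> x powr - Re s"
  using assms by (simp add: norm_powr_real_powr powr_mono2')

lemma closed_segment_of_realD:
  assumes "z \<in> closed_segment (complex_of_real x) (of_real y)" "x \<le> y"
  obtains t where "z = of_real t" "x \<le> t" "t \<le> y"
proof -
  have "z \<in> complex_of_real ` {x..y}"
    using assms by (simp only: closed_segment_of_real closed_segment_eq_real_ivl if_True)
  thus ?thesis using that by auto
qed

lemma powr_diff_bound:
  assumes x: "0 < x" "x \<le> y" and s: "Re s \<ge> 0"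
  shows "norm (complex_of_real x powr - s - of_real y powr - s) \<le> norm s * (y - x) * x powr (- Re s - 1)"
proof -
  let ?S = "closed_segment (complex_of_real x) (of_real y)"
  have "norm (complex_of_real x powr - s - of_real y powr - s)
      \<le> (norm s * x powr (- Re s - 1)) * norm (complex_of_real x - of_real y)"
  proof (rule field_differentiable_bound[where S = ?S and f' = "\<lambda>z. - s * z powr (- s - 1)"])
    fix z assume "z \<in> ?S"
    then obtain t where t: "z = of_real t" "x \<le> t" "t \<le> y" using closed_segment_of_realD x(2) by metis
    have "z \<notin> \<real>\<^sub>\<le>\<^sub>0" using t x by (auto simp: complex_nonpos_Reals_iff)
    thus "((\<lambda>z. z powr - s) has_field_derivative - s * z powr (- s - 1)) (at z within ?S)"
      by (rule has_field_derivative_at_within[OF has_field_derivative_powr])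
    show "norm (- s * z powr (- s - 1)) \<le> norm s * x powr (- Re s - 1)"
      using norm_powr_le[of x t "s + 1"] t x s
      by (auto simp: norm_mult intro!: mult_left_mono)
  qed auto
  also have "norm (complex_of_real x - of_real y) = y - x"
    unfolding of_real_diff[symmetric] norm_of_real using x by simp
  finally show ?thesis by (simp add: mult_ac)
qed

text \<open>This is \<open>s - 1\<close> times the difference between \<open>n^(-s)\<close> and half
  the integral of \<open>x^(-s)\<close> over \<open>[n, n + 2]\<close>, with the integral evaluated
  so that the expression also makes sense at \<open>s = 1\<close>.\<close>

definition zeta_term :: "nat \<Rightarrow> complex \<Rightarrow> complex" where
  "zeta_term n s =
    (s - 1) * of_nat n powr - s + (of_nat (n + 2) powr (1 - s) - of_nat n powr (1 - s)) / 2"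

lemma zeta_term_bound:
  assumes n: "n > 0" and s: "Re s \<ge> 0"
  shows "norm (zeta_term n s) \<le> 2 * norm (s - 1) * norm s * real n powr (- Re s - 1)"
proof -
  define x where "x = real n"
  have x: "x > 0" using n by (simp add: x_def)
  let ?S = "closed_segment (complex_of_real x) (of_real (x + 2))"
  \<comment> \<open>This function replaces the integral: its increment over
    \<open>[x, x + 2]\<close> is \<open>2 * zeta_term n s\<close>, while its derivative
    \<open>(s - 1) * (x^(-s) - z^(-s))\<close> is small by \<open>powr_diff_bound\<close>.\<close>
  let ?\<phi> = "\<lambda>z. (s - 1) * z * of_real x powr - s + z powr (1 - s)"
  have "norm (?\<phi> (of_real (x + 2)) - ?\<phi> (of_real x))
      \<le> (norm (s - 1) * (norm s * 2 * x powr (- Re s - 1))) * norm (complex_of_real (x + 2) - of_real x)"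
  proof (rule field_differentiable_bound[where S = ?S and
        f' = "\<lambda>z. (s - 1) * (of_real x powr - s - z powr - s)"])
    fix z assume "z \<in> ?S"
    then obtain t where t: "z = of_real t" "x \<le> t" "t \<le> x + 2" using closed_segment_of_realD[of z x "x + 2"] by auto
    have "z \<notin> \<real>\<^sub>\<le>\<^sub>0" using t x by (auto simp: complex_nonpos_Reals_iff)
    hence "(?\<phi> has_field_derivative (s - 1) * of_real x powr - s + (1 - s) * z powr (1 - s - 1)) (at z)"
      by (intro DERIV_add DERIV_cmult_right has_field_derivative_powr DERIV_cmult_Id)
    from has_field_derivative_at_within[OF this]
    show "(?\<phi> has_field_derivative (s - 1) * (of_real x powr - s - z powr - s)) (at z within ?S)"
      by (simp add: algebra_simps)
    have "norm (of_real x powr - s - z powr - s) \<le> norm s * (t - x) * x powr (- Re s - 1)"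
      using powr_diff_bound[OF x t(2) s] t by simp
    also have "\<dots> \<le> norm s * 2 * x powr (- Re s - 1)"
      using t by (intro mult_right_mono mult_left_mono) auto
    finally show "norm ((s - 1) * (of_real x powr - s - z powr - s))
        \<le> norm (s - 1) * (norm s * 2 * x powr (- Re s - 1))"
      by (auto simp: norm_mult intro!: mult_left_mono)
  qed auto
  also have "?\<phi> (of_real (x + 2)) - ?\<phi> (of_real x) = 2 * zeta_term n s"
    by (simp add: zeta_term_def x_def algebra_simps diff_divide_distrib)
  finally show ?thesis by (simp add: norm_mult x_def mult_ac)
qed

text \<open>\<open>L_chi\<close> is the series of \<open>\<Sum>a\<^sub>n n\<^sup>-\<^sup>s\<close> with consecutive terms paired, so that it converges absolutely
  for \<open>Re s > 0\<close>. \<open>Z_odd s\<close> is \<open>(s - 1) \<Sum>n\<^sup>-\<^sup>s\<close> over odd \<open>n\<close>; each \<open>n\<^sup>-\<^sup>s\<close> is compared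
  with half the integral of \<open>x\<^sup>-\<^sup>s\<close> over \<open>[n, n + 2]\<close>.\<close>

definition L_chi :: "complex \<Rightarrow> complex" where
  "L_chi s = (\<Sum>k. of_nat (4 * k + 1) powr - s - of_nat (4 * k + 3) powr - s)"

definition Z_odd :: "complex \<Rightarrow> complex" where
  "Z_odd s = 1 / 2 + (\<Sum>k. zeta_term (2 * k + 1) s)"

lemma half_plane_dominated:
  fixes f :: "nat \<Rightarrow> complex \<Rightarrow> complex"
  assumes C: "\<And>r. C r \<ge> 0"
    and f: "\<And>k s R. Re s > 0 \<Longrightarrow> norm s \<le> R \<Longrightarrow> norm (f k s) \<le> C R * real (Suc k) powr (- Re s - 1)"
    and x: "Re x > 0"
  shows "\<exists>d h. 0 < d \<and> summable h \<and> (\<forall>n. \<forall>y\<in>ball x d \<inter> {s. Re s > 0}. norm (f n y) \<le> h n)"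
proof (intro exI conjI allI ballI)
  \<comment> \<open>With this radius \<open>Re y \<ge> Re x / 2\<close> on the ball, so the
    exponents stay uniformly below \<open>-1\<close>.\<close>
  let ?d = "Re x / 2"
  show "0 < ?d" using x by simp
  have "summable (\<lambda>k. real (Suc k) powr (- ?d - 1))"
    using x by (subst summable_Suc_iff) (simp add: summable_real_powr_iff)
  thus "summable (\<lambda>k. C (norm x + ?d) * real (Suc k) powr (- ?d - 1))"
    by (rule summable_mult)
  fix n y assume y: "y \<in> ball x ?d \<inter> {s. Re s > 0}"
  have ny: "norm y \<le> norm x + ?d"
    using y norm_triangle_ineq2[of y x] by (simp add: dist_norm norm_minus_commute)
  have ry: "Re y \<ge> ?d"
    using y complex_Re_le_cmod[of "x - y"] by (simp add: dist_norm)
  have "norm (f n y) \<le> C (norm x + ?d) * real (Suc n) powr (- Re y - 1)"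
    using f[OF _ ny] y by simp
  also have "\<dots> \<le> C (norm x + ?d) * real (Suc n) powr (- ?d - 1)"
    using ry by (intro mult_left_mono C powr_mono) auto
  finally show "norm (f n y) \<le> C (norm x + ?d) * real (Suc n) powr (- ?d - 1)" .
qed

lemma open_half_plane: "open {s. Re s > c}"
  by (rule open_halfspace_Re_gt)

lemma norm_L_chi_term_le:
  assumes "Re s > 0"
  shows "norm (of_nat (4 * k + 1) powr - s - of_nat (4 * k + 3) powr - s :: complex)
    \<le> 2 * norm s * real (Suc k) powr (- Re s - 1)"
proof -
  have "norm (of_nat (4 * k + 1) powr - s - of_nat (4 * k + 3) powr - s :: complex)
      \<le> norm s * 2 * real (4 * k + 1) powr (- Re s - 1)"
    using powr_diff_bound[of "real (4 * k + 1)" "real (4 * k + 3)" s] assms by simp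
  also have "\<dots> \<le> norm s * 2 * real (Suc k) powr (- Re s - 1)"
    using assms by (intro mult_left_mono powr_mono2') auto
  finally show ?thesis by (simp add: mult_ac)
qed

lemma
  shows holomorphic_L_chi: "L_chi holomorphic_on {s. Re s > 0}"
    and summable_L_chi: "Re s > 0 \<Longrightarrow>
      summable (\<lambda>k. of_nat (4 * k + 1) powr - s - of_nat (4 * k + 3) powr - s :: complex)"
proof -
  have bound: "\<exists>d h. 0 < d \<and> summable h \<and> (\<forall>n. \<forall>y\<in>ball x d \<inter> {s. Re s > 0}.
      norm (of_nat (4 * n + 1) powr - y - of_nat (4 * n + 3) powr - y :: complex) \<le> h n)"
    if "x \<in> {s. Re s > 0}" for x
  proof (rule half_plane_dominated[where C = "\<lambda>R. 2 * \<bar>R\<bar>"])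
    fix k s R assume *: "Re s > 0" "norm s \<le> R"
    show "norm (of_nat (4 * k + 1) powr - s - of_nat (4 * k + 3) powr - s :: complex)
        \<le> 2 * \<bar>R\<bar> * real (Suc k) powr (- Re s - 1)"
      using *(2) by (intro order.trans[OF norm_L_chi_term_le[OF *(1)]] mult_right_mono) auto
  qed (use that in auto)
  have hol: "(\<lambda>s. of_nat (4 * n + 1) powr - s - of_nat (4 * n + 3) powr - s :: complex)
      holomorphic_on {s. Re s > 0}" for n
    by (intro holomorphic_intros)
  show "L_chi holomorphic_on {s. Re s > 0}"
    unfolding L_chi_def by (rule holomorphic_suminf(1)[OF open_half_plane hol bound])
  show "Re s > 0 \<Longrightarrow> summable (\<lambda>k. of_nat (4 * k + 1) powr - s - of_nat (4 * k + 3) powr - s :: complex)"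
    using holomorphic_suminf(2)[OF open_half_plane hol bound] by simp
qed

lemma norm_zeta_term_le:
  assumes "Re s > 0" "norm s \<le> R"
  shows "norm (zeta_term (2 * k + 1) s) \<le> (2 * (\<bar>R\<bar> + 1) * \<bar>R\<bar>) * real (Suc k) powr (- Re s - 1)"
proof -
  have "norm (zeta_term (2 * k + 1) s)
      \<le> 2 * norm (s - 1) * norm s * real (2 * k + 1) powr (- Re s - 1)"
    using assms by (intro zeta_term_bound) auto
  also have "\<dots> \<le> 2 * (\<bar>R\<bar> + 1) * \<bar>R\<bar> * real (Suc k) powr (- Re s - 1)"
    using assms norm_triangle_ineq4[of s 1] by (intro mult_mono powr_mono2') auto
  finally show ?thesis .
qed

lemma holomorphic_Z_odd: "Z_odd holomorphic_on {s. Re s > 0}"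
proof -
  have bound: "\<exists>d h. 0 < d \<and> summable h \<and> (\<forall>n. \<forall>y\<in>ball x d \<inter> {s. Re s > 0}.
      norm (zeta_term (2 * n + 1) y) \<le> h n)"
    if "x \<in> {s. Re s > 0}" for x
    by (rule half_plane_dominated[where C = "\<lambda>R. 2 * (\<bar>R\<bar> + 1) * \<bar>R\<bar>"])
      (use that norm_zeta_term_le in auto)
  have hol: "zeta_term (2 * n + 1) holomorphic_on {s. Re s > 0}" for n
    unfolding zeta_term_def by (intro holomorphic_intros) auto
  show ?thesis
    unfolding Z_odd_def
    by (intro holomorphic_intros holomorphic_suminf(1)[OF open_half_plane hol bound])
qed

section \<open>Agreement of the continuations with the Dirichlet series\<close>

lemma sums_pairs:
  fixes f :: "nat \<Rightarrow> 'a :: real_normed_vector"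
  shows "f sums s \<Longrightarrow> (\<lambda>k. f (2 * k) + f (2 * k + 1)) sums s"
proof -
  assume "f sums s"
  hence "(\<lambda>n. sum f {n * 2..<n * 2 + 2}) sums s" by (rule sums_group) simp
  also have "(\<lambda>n. sum f {n * 2..<n * 2 + 2}) = (\<lambda>k. f (2 * k) + f (2 * k + 1))"
  proof
    fix n :: nat
    have "{n * 2..<n * 2 + 2} = {2 * n, 2 * n + 1}" by auto
    thus "sum f {n * 2..<n * 2 + 2} = f (2 * n) + f (2 * n + 1)" by simp
  qed
  finally show ?thesis .
qed

lemma a_seq_odd: "a_seq (2 * k + 1) = (-1) ^ k"
  by (simp add: a_seq_def)

lemma infsum_L_chi:
  assumes "Re s > 1"
  shows "(\<Sum>\<^sub>\<infinity>n\<in>odds. of_int (a_seq n) * of_nat n powr - s) = L_chi s"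
proof -
  have "(\<lambda>n. norm (of_int (a_seq n) * of_nat n powr - s :: complex)) summable_on odds"
    by (intro summable_norm_unimodular_mult dirichlet_terms_summable assms) simp
  from has_sum_infsum[OF abs_summable_summable[OF this]]
  have "(\<lambda>k. of_int (a_seq (2 * k + 1)) * of_nat (2 * k + 1) powr - s) sums
      (\<Sum>\<^sub>\<infinity>n\<in>odds. of_int (a_seq n) * of_nat n powr - s)"
    by (rule odds_sums)
  from sums_pairs[OF this]
  have "(\<lambda>k. of_nat (4 * k + 1) powr - s - of_nat (4 * k + 3) powr - s) sums
      (\<Sum>\<^sub>\<infinity>n\<in>odds. of_int (a_seq n) * of_nat n powr - s)"
    unfolding a_seq_odd by (simp add: algebra_simps)
  thus ?thesis by (simp add: L_chi_def sums_iff)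
qed

text \<open>The integral parts telescope to an integral over \<open>[1, \<infinity>)\<close>, which
  accounts for the constant \<open>1 / 2\<close> in \<open>Z_odd\<close>.\<close>

lemma infsum_Z_odd:
  assumes "Re s > 1"
  shows "(s - 1) * (\<Sum>\<^sub>\<infinity>n\<in>odds. of_nat n powr - s) = Z_odd s"
proof -
  let ?g = "\<lambda>k. of_nat (2 * k + 1) powr (1 - s) :: complex"
  have "(\<lambda>k. of_nat (2 * k + 1) powr - s) sums (\<Sum>\<^sub>\<infinity>n\<in>odds. of_nat n powr - s)"
    by (rule odds_sums[OF has_sum_infsum[OF abs_summable_summable[OF dirichlet_terms_summable[OF assms]]]])
  note A = this
  have B: "(\<lambda>k. ?g (Suc k) - ?g k) sums (0 - ?g 0)"
  proof (rule telescope_sums)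
    have "((\<lambda>x. x powr (1 - Re s)) \<longlongrightarrow> 0) at_top"
      using assms by (intro tendsto_neg_powr filterlim_ident) auto
    moreover have "filterlim (\<lambda>k. real (2 * k + 1)) at_top sequentially"
      by real_asymp
    ultimately have "(\<lambda>k. real (2 * k + 1) powr (1 - Re s)) \<longlonglongrightarrow> 0"
      by (rule filterlim_compose)
    thus "?g \<longlonglongrightarrow> 0"
      unfolding tendsto_norm_zero_iff[of ?g, symmetric] norm_of_nat_powr by simp
  qed
  have "(\<lambda>k. (s - 1) * of_nat (2 * k + 1) powr - s + (?g (Suc k) - ?g k) / 2) sums
      ((s - 1) * (\<Sum>\<^sub>\<infinity>n\<in>odds. of_nat n powr - s) + (0 - ?g 0) / 2)"
    by (rule sums_add[OF sums_mult[OF A] sums_divide[OF B]])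
  also have "(\<lambda>k. (s - 1) * of_nat (2 * k + 1) powr - s + (?g (Suc k) - ?g k) / 2) =
      (\<lambda>k. zeta_term (2 * k + 1) s)"
  proof
    fix k :: nat
    have "2 * Suc k + 1 = (2 * k + 1) + 2" by simp
    thus "(s - 1) * of_nat (2 * k + 1) powr - s + (?g (Suc k) - ?g k) / 2 = zeta_term (2 * k + 1) s"
      by (simp only: zeta_term_def)
  qed
  finally have "(\<Sum>k. zeta_term (2 * k + 1) s) =
      (s - 1) * (\<Sum>\<^sub>\<infinity>n\<in>odds. of_nat n powr - s) + (0 - ?g 0) / 2"
    by (rule sums_unique[symmetric])
  thus ?thesis by (simp only: Z_odd_def) simp
qed

text \<open>Real coefficients make the zeros symmetric: a zero at \<open>1 + i t\<close> comes with
  one at \<open>1 - i t\<close>.\<close>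

lemma L_chi_cnj: "Re s > 0 \<Longrightarrow> L_chi (cnj s) = cnj (L_chi s)"
proof -
  assume s: "Re s > 0"
  have "(\<lambda>k. cnj (of_nat (4 * k + 1) powr - s - of_nat (4 * k + 3) powr - s)) sums cnj (L_chi s)"
    unfolding sums_cnj L_chi_def by (rule summable_sums[OF summable_L_chi[OF s]])
  thus ?thesis by (simp add: L_chi_def sums_iff cnj_powr complex_nonpos_Reals_iff)
qed

section \<open>Nonvanishing on the line of abscissa one\<close>

definition zeta_odd :: "complex \<Rightarrow> complex" where
  "zeta_odd s = (\<Sum>\<^sub>\<infinity>n\<in>odds. of_nat n powr - s)"

lemma zeta_odd_has_sum: "Re s > 1 \<Longrightarrow> ((\<lambda>n. of_nat n powr - s) has_sum zeta_odd s) odds"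
  unfolding zeta_odd_def
  by (rule has_sum_infsum[OF abs_summable_summable[OF dirichlet_terms_summable]])

lemma zeta_odd_sums: "Re s > 1 \<Longrightarrow> (\<lambda>k. of_nat (2 * k + 1) powr - s) sums zeta_odd s"
  by (rule odds_sums[OF zeta_odd_has_sum])

lemma Z_odd_eq: "Re s > 1 \<Longrightarrow> Z_odd s = (s - 1) * zeta_odd s"
  by (simp add: infsum_Z_odd zeta_odd_def)

lemma zeta_odd_double:
  assumes "Re s > 1"
  shows "zeta_odd (2 * s) = zeta_odd s * (\<Sum>\<^sub>\<infinity>n\<in>odds. of_int (liouville n) * of_nat n powr - s)"
  using infsumI[OF liouville_convolution[OF dirichlet_terms_summable[OF assms] of_nat_mult_powr]]
  by (simp only: zeta_odd_def of_nat_square_powr)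

text \<open>For odd \<open>n \<ge> 3\<close> split \<open>n^(-Re s)\<close> as
  \<open>n^(2 - Re s) * n^(-2)\<close>: the first factor is at most \<open>3^(2 - Re s)\<close>, the
  second is summable.\<close>

lemma norm_zeta_odd_minus_1_le:
  obtains C where "\<And>s. Re s \<ge> 2 \<Longrightarrow> norm (zeta_odd s - 1) \<le> 3 powr (2 - Re s) * C"
proof
  fix s assume s: "Re s \<ge> 2"
  let ?h = "\<lambda>k. real (2 * k + 3) powr - 2"
  have h: "summable ?h"
  proof (rule summable_comparison_test'[where N = 0])
    show "summable (\<lambda>k. real (Suc k) powr - 2)"
      by (subst summable_Suc_iff) (simp add: summable_real_powr_iff)
    show "norm (?h n) \<le> real (Suc n) powr - 2" for n
      by (auto intro!: powr_mono2')
  qed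
  have "(\<lambda>k. of_nat (2 * Suc k + 1) powr - s) sums (zeta_odd s - 1)"
    using sums_split_initial_segment[OF zeta_odd_sums[of s], of 1] s by simp
  hence eq: "zeta_odd s - 1 = (\<Sum>k. of_nat (2 * Suc k + 1) powr - s)"
    by (rule sums_unique)
  have b: "norm (of_nat (2 * Suc k + 1) powr - s :: complex) \<le> 3 powr (2 - Re s) * ?h k" for k
  proof -
    have "norm (of_nat (2 * Suc k + 1) powr - s :: complex) = real (2 * k + 3) powr ((2 - Re s) + - 2)"
      unfolding norm_of_nat_powr by (simp add: eval_nat_numeral)
    also have "\<dots> = real (2 * k + 3) powr (2 - Re s) * ?h k"
      by (rule powr_add)
    also have "\<dots> \<le> 3 powr (2 - Re s) * ?h k"
      using s by (intro mult_right_mono powr_mono2') auto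
    finally show ?thesis .
  qed
  have "norm (zeta_odd s - 1) \<le> (\<Sum>k. 3 powr (2 - Re s) * ?h k)"
    unfolding eq by (rule norm_suminf_le[OF b summable_mult[OF h]])
  also have "\<dots> = 3 powr (2 - Re s) * (\<Sum>k. ?h k)"
    by (rule suminf_mult[OF h])
  finally show "norm (zeta_odd s - 1) \<le> 3 powr (2 - Re s) * (\<Sum>k. ?h k)" .
qed

text \<open>A zero at \<open>s\<close> propagates to \<open>2 s\<close>, \<open>4 s\<close>, \<open>...\<close>, but \<open>zeta_odd\<close> tends to \<open>1\<close> as \<open>Re s\<close> grows.\<close>

lemma zeta_odd_nonzero:
  assumes s: "Re s > 1"
  shows "zeta_odd s \<noteq> 0"
proof
  assume zero: "zeta_odd s = 0"
  have *: "zeta_odd (2 ^ k * s) = 0 \<and> Re (2 ^ k * s) > real k" for k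
  proof (induction k)
    case 0
    thus ?case using zero s by simp
  next
    case (Suc k)
    have pow: "Re (2 ^ j * s) = 2 ^ j * Re s" for j
    proof -
      have "2 ^ j * s = (2 ^ j) *\<^sub>R s" by (simp add: scaleR_conv_of_real)
      thus ?thesis by simp
    qed
    have "1 * 1 < 2 ^ k * Re s" using s by (intro mult_le_less_imp_less) auto
    hence 1: "Re (2 ^ k * s) > 1" by (simp add: pow)
    have "zeta_odd (2 ^ Suc k * s) = 0"
      using zeta_odd_double[OF 1] Suc by (simp add: mult.assoc)
    moreover have "Re (2 ^ Suc k * s) > real (Suc k)"
      using 1 Suc by (simp add: pow)
    ultimately show ?case by blast
  qed
  obtain C where C: "\<And>s. Re s \<ge> 2 \<Longrightarrow> norm (zeta_odd s - 1) \<le> 3 powr (2 - Re s) * C"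
    using norm_zeta_odd_minus_1_le by blast
  have "((\<lambda>k. 3 powr (2 - real k) * \<bar>C\<bar>) \<longlongrightarrow> 0) sequentially"
    by real_asymp
  hence "\<forall>\<^sub>F k in sequentially. 3 powr (2 - real k) * \<bar>C\<bar> < 1"
    by (rule order_tendstoD) simp
  hence "\<forall>\<^sub>F k in sequentially. 3 powr (2 - real k) * \<bar>C\<bar> < 1 \<and> k \<ge> 2"
    using eventually_ge_at_top eventually_conj by blast
  then obtain k where k: "3 powr (2 - real k) * \<bar>C\<bar> < 1" "k \<ge> 2"
    using eventually_happens'[OF sequentially_bot] by blast
  have "1 \<le> 3 powr (2 - Re (2 ^ k * s)) * C"
    using C[of "2 ^ k * s"] *[of k] k by auto
  also have "\<dots> \<le> 3 powr (2 - Re (2 ^ k * s)) * \<bar>C\<bar>"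
    by (intro mult_left_mono) auto
  also have "\<dots> \<le> 3 powr (2 - real k) * \<bar>C\<bar>"
    using *[of k] by (intro mult_right_mono powr_mono) auto
  finally show False using k by simp
qed

lemma higher_deriv_dirichlet_polynomial:
  assumes "\<And>k. n k > 0"
  shows "(deriv ^^ m) (\<lambda>s. \<Sum>k<N. c k * of_nat (n k) powr - s) =
    (\<lambda>s. \<Sum>k<N. c k * (- Ln (of_nat (n k))) ^ m * of_nat (n k) powr - s :: complex)"
proof (induction m)
  case (Suc m)
  have "deriv (\<lambda>s. \<Sum>k<N. c k * (- Ln (of_nat (n k))) ^ m * of_nat (n k) powr - s) s =
      (\<Sum>k<N. c k * (- Ln (of_nat (n k))) ^ Suc m * of_nat (n k) powr - s)" for s
  proof (rule DERIV_imp_deriv, rule DERIV_sum)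
    fix k
    have "((\<lambda>s. of_nat (n k) powr - s) has_field_derivative
        (- Ln (of_nat (n k)) * of_nat (n k) powr - s)) (at s)"
      using DERIV_chain2[OF has_field_derivative_powr_right DERIV_minus[OF DERIV_ident],
          of "of_nat (n k)" s] assms[of k] by (simp add: mult.commute)
    from DERIV_cmult[OF this, of "c k * (- Ln (of_nat (n k))) ^ m"]
    show "((\<lambda>s. c k * (- Ln (of_nat (n k))) ^ m * of_nat (n k) powr - s) has_field_derivative
        c k * (- Ln (of_nat (n k))) ^ Suc m * of_nat (n k) powr - s) (at s)"
      by (simp add: mult_ac)
  qed
  thus ?case by (simp add: Suc fun_eq_iff)
qed simp

text \<open>Landau's argument: the Taylor coefficients of a Dirichlet series with nonnegative coefficients
  alternate in sign, so its continuation to the left of \<open>2\<close> along the real axis can only grow.\<close>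

lemma landau_lower_bound:
  fixes c :: "nat \<Rightarrow> real" and G :: "complex \<Rightarrow> complex"
  assumes c: "\<And>k. c k \<ge> 0" and n: "\<And>k. n k > 0" and n0: "n 0 = 1"
    and G: "G holomorphic_on {s. Re s > r}"
    and sums: "\<And>s. Re s > 1 \<Longrightarrow> (\<lambda>k. of_real (c k) * of_nat (n k) powr - s) sums G s"
    and x: "r < x" "x \<le> 2"
  shows "Re (G (of_real x)) \<ge> c 0"
proof -
  define P where "P = (\<lambda>N s. \<Sum>k<N. complex_of_real (c k) * of_nat (n k) powr - s)"
  \<comment> \<open>On this ball the series is dominated by its value at \<open>3 / 2\<close>, which
    yields uniform convergence near the centre \<open>2\<close>.\<close>
  have ball: "Re s > 3 / 2" if "s \<in> ball (2::complex) (1 / 2)" for s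
    using that complex_Re_le_cmod[of "2 - s"] by (simp add: dist_norm)
  have term_norm: "norm (complex_of_real (c k) * of_nat (n k) powr - s) = c k * real (n k) powr - Re s" for k s
    using c[of k] by (simp add: norm_mult norm_of_nat_powr)
  have lim: "uniform_limit (ball 2 (1 / 2)) P G sequentially"
  proof -
    have "uniform_limit (ball 2 (1 / 2)) P (\<lambda>s. suminf (\<lambda>k. of_real (c k) * of_nat (n k) powr - s)) sequentially"
      unfolding P_def
    proof (rule Weierstrass_m_test)
      have "summable (\<lambda>k. Re (complex_of_real (c k) * of_nat (n k) powr - complex_of_real (3 / 2)))"
        by (rule summable_Re[OF sums_summable[OF sums]]) simp
      moreover have "Re (complex_of_real (c k) * of_nat (n k) powr - complex_of_real (3 / 2)) =
          c k * real (n k) powr - (3 / 2)" for k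
      proof -
        have "complex_of_nat (n k) powr - complex_of_real (3 / 2) = of_real (real (n k) powr - (3 / 2))"
          using powr_of_real[of "real (n k)" "- (3 / 2)"] by simp
        thus ?thesis by simp
      qed
      ultimately show "summable (\<lambda>k. c k * real (n k) powr - (3 / 2))" by (simp only:)
      fix k s assume "s \<in> ball (2::complex) (1 / 2)"
      thus "norm (complex_of_real (c k) * of_nat (n k) powr - s) \<le> c k * real (n k) powr - (3 / 2)"
        unfolding term_norm using ball[of s] c[of k] n[of k]
        by (intro mult_left_mono powr_mono) auto
    qed
    moreover have eq: "(\<Sum>k. of_real (c k) * of_nat (n k) powr - s) = G s" if "s \<in> ball 2 (1 / 2)" for s
      using sums[of s] ball[OF that] by (simp add: sums_iff)
    ultimately show ?thesis
      by (simp only: uniform_limit_cong'[OF refl eq])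
  qed
  \<comment> \<open>Each derivative of a Dirichlet polynomial brings down a factor
    \<open>- ln n\<close>. The sign thus known for finite sums passes to \<open>G\<close> because
    derivatives of uniform limits are limits of derivatives.\<close>
  have sign: "Re ((- 1) ^ m * (deriv ^^ m) G 2) \<ge> 0" for m
  proof (rule tendsto_lowerbound)
    have "(\<lambda>N. (deriv ^^ m) (P N) 2) \<longlonglongrightarrow> (deriv ^^ m) G 2"
    proof (rule higher_deriv_complex_uniform_limit[OF lim])
      show "\<forall>\<^sub>F N in sequentially. P N holomorphic_on ball 2 (1 / 2)"
        unfolding P_def using n by (intro always_eventually allI holomorphic_intros)
    qed auto
    thus "(\<lambda>N. Re ((- 1) ^ m * (deriv ^^ m) (P N) 2)) \<longlonglongrightarrow> Re ((- 1) ^ m * (deriv ^^ m) G 2)"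
      by (intro tendsto_intros)
    show "\<forall>\<^sub>F N in sequentially. 0 \<le> Re ((- 1) ^ m * (deriv ^^ m) (P N) 2)"
    proof (intro always_eventually allI)
      fix N
      have "(- 1) ^ m * (deriv ^^ m) (P N) 2 =
          (\<Sum>k<N. (- 1) ^ m * (of_real (c k) * (- Ln (of_nat (n k))) ^ m * of_nat (n k) powr - 2))"
        unfolding P_def higher_deriv_dirichlet_polynomial[OF n] by (rule sum_distrib_left)
      also have "\<dots> = (\<Sum>k<N. complex_of_real (c k * ln (real (n k)) ^ m * real (n k) powr - 2))"
      proof (rule sum.cong[OF refl])
        fix k
        have "Ln (of_nat (n k)) = of_real (ln (real (n k)))"
          using n[of k] Ln_of_real[of "real (n k)"] by simp
        moreover have "complex_of_nat (n k) powr - 2 = of_real (real (n k) powr - 2)"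
          using powr_of_real[of "real (n k)" "- 2"] by simp
        moreover have "(- 1) ^ m * (- complex_of_real (ln (real (n k)))) ^ m = of_real (ln (real (n k)) ^ m)"
          by (simp flip: power_mult_distrib)
        moreover have "(- 1) ^ m * (a * b ^ m * d) = a * ((- 1) ^ m * b ^ m) * d" for a b d :: complex
          by (simp only: mult_ac)
        ultimately show "(- 1) ^ m * (of_real (c k) * (- Ln (of_nat (n k))) ^ m * of_nat (n k) powr - 2) =
            complex_of_real (c k * ln (real (n k)) ^ m * real (n k) powr - 2)"
          by (simp only: of_real_mult)
      qed
      finally have "Re ((- 1) ^ m * (deriv ^^ m) (P N) 2) =
          (\<Sum>k<N. c k * ln (real (n k)) ^ m * real (n k) powr - 2)"
        by (simp only: Re_sum Re_complex_of_real)
      moreover have "(\<Sum>k<N. c k * ln (real (n k)) ^ m * real (n k) powr - 2) \<ge> 0"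
      proof (intro sum_nonneg mult_nonneg_nonneg zero_le_power c)
        show "ln (real (n k)) \<ge> 0" for k using n[of k] by (intro ln_ge_zero) simp
      qed simp
      ultimately show "0 \<le> Re ((- 1) ^ m * (deriv ^^ m) (P N) 2)" by (simp only:)
    qed
  qed simp
  \<comment> \<open>The Taylor disc about \<open>2\<close> extends as far left as \<open>r\<close>,
    which may lie beyond the region where the Dirichlet series is known to converge; the Taylor
    series therefore reaches every \<open>x\<close> with \<open>r < x \<le> 2\<close>.\<close>
  have hol: "G holomorphic_on ball 2 (2 - r)"
  proof (rule holomorphic_on_subset[OF G], rule subsetI)
    fix s assume "s \<in> ball (2::complex) (2 - r)"
    thus "s \<in> {s. Re s > r}" using complex_Re_le_cmod[of "2 - s"] by (simp add: dist_norm)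
  qed
  have "(\<lambda>m. (deriv ^^ m) G 2 / fact m * (of_real x - 2) ^ m) sums G (of_real x)"
  proof (rule holomorphic_power_series[OF hol])
    have "dist 2 (complex_of_real x) = \<bar>2 - x\<bar>"
      by (metis dist_norm norm_of_real of_real_diff of_real_numeral)
    thus "complex_of_real x \<in> ball 2 (2 - r)" using x by simp
  qed
  note taylor = this
  have S: "(\<lambda>m. Re ((- 1) ^ m * (deriv ^^ m) G 2) * ((2 - x) ^ m / fact m)) sums Re (G (of_real x))"
  proof -
    have "(\<lambda>m. Re ((deriv ^^ m) G 2 / fact m * (of_real x - 2) ^ m)) =
        (\<lambda>m. Re ((- 1) ^ m * (deriv ^^ m) G 2) * ((2 - x) ^ m / fact m))"
    proof
      fix m
      have "(complex_of_real x - 2) ^ m = (- 1) ^ m * of_real ((2 - x) ^ m)"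
        by (simp flip: power_mult_distrib)
      hence "(deriv ^^ m) G 2 / fact m * (of_real x - 2) ^ m =
          ((- 1) ^ m * (deriv ^^ m) G 2) * of_real ((2 - x) ^ m / fact m)"
        by (simp add: field_simps)
      moreover have "Re (z * of_real r) = Re z * r" for z r by simp
      ultimately show "Re ((deriv ^^ m) G 2 / fact m * (of_real x - 2) ^ m) =
          Re ((- 1) ^ m * (deriv ^^ m) G 2) * ((2 - x) ^ m / fact m)"
        by (simp only:)
    qed
    with sums_Re[OF taylor] show ?thesis by (simp only:)
  qed
  \<comment> \<open>Both remaining inequalities drop nonnegative terms: here all but
    \<open>k = 0\<close> of the Dirichlet series at \<open>2\<close>, next all but
    \<open>m = 0\<close> of the Taylor series at \<open>x\<close>.\<close>
  have "c 0 \<le> Re (G 2)"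
  proof -
    have "(\<lambda>k. Re (of_real (c k) * of_nat (n k) powr - 2)) sums Re (G 2)"
      by (rule sums_Re[OF sums]) simp
    moreover have "Re (of_real (c k) * of_nat (n k) powr - 2) = c k * real (n k) powr - 2" for k
      using powr_of_real[of "real (n k)" "- 2"] by simp
    ultimately have s: "(\<lambda>k. c k * real (n k) powr - 2) sums Re (G 2)" by (simp only:)
    have "sum (\<lambda>k. c k * real (n k) powr - 2) {0} \<le> suminf (\<lambda>k. c k * real (n k) powr - 2)"
      using s c by (intro sum_le_suminf) (auto simp: sums_iff)
    thus ?thesis using s n0 by (simp add: sums_iff)
  qed
  moreover have "Re (G 2) \<le> Re (G (of_real x))"
  proof -
    let ?t = "\<lambda>m. Re ((- 1) ^ m * (deriv ^^ m) G 2) * ((2 - x) ^ m / fact m)"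
    have "?t m \<ge> 0" for m using sign[of m] x by simp
    hence "sum ?t {0} \<le> suminf ?t"
      by (intro sum_le_suminf sums_summable[OF S]) auto
    thus ?thesis using sums_unique[OF S] by simp
  qed
  ultimately show ?thesis by simp
qed

lemma not_summable_inverse_odd: "\<not> summable (\<lambda>k. 1 / real (2 * k + 1))"
proof
  assume "summable (\<lambda>k. 1 / real (2 * k + 1))"
  hence "summable (\<lambda>k. 2 * (1 / real (2 * k + 1)))" by (rule summable_mult)
  hence "summable (\<lambda>k. 1 / real (Suc k))"
    by (rule summable_comparison_test') (simp add: field_simps)
  thus False
    using not_summable_harmonic[where 'a = real]
    unfolding summable_Suc_iff[of "\<lambda>k. 1 / real k"] by (simp add: inverse_eq_divide)
qed

text \<open>This is all that is used of the pole at \<open>1\<close>. Fixing a partial sum and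
  letting \<open>x\<close> decrease to \<open>1\<close> would bound the partial sums of the
  divergent series of \<open>1 / (2 k + 1)\<close>.\<close>

lemma zeta_odd_unbounded:
  assumes "\<And>x. 1 < x \<Longrightarrow> x \<le> 2 \<Longrightarrow> norm (zeta_odd (of_real x)) \<le> M"
  shows False
proof -
  have "(\<Sum>k<N. 1 / real (2 * k + 1)) \<le> M" for N
  proof (rule tendsto_upperbound)
    have "((\<lambda>x. \<Sum>k<N. real (2 * k + 1) powr - x) \<longlongrightarrow> (\<Sum>k<N. real (2 * k + 1) powr - 1)) (at_right 1)"
      by (intro tendsto_intros) auto
    thus "((\<lambda>x. \<Sum>k<N. real (2 * k + 1) powr - x) \<longlongrightarrow> (\<Sum>k<N. 1 / real (2 * k + 1))) (at_right 1)"
      by (simp add: powr_minus_divide)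
    have "\<forall>\<^sub>F x :: real in at_right 1. x \<in> {1<..<2}"
      by (rule eventually_at_right_real) simp
    thus "\<forall>\<^sub>F x in at_right 1. (\<Sum>k<N. real (2 * k + 1) powr - x) \<le> M"
    proof eventually_elim
      case (elim x)
      have Re: "Re (of_nat (2 * k + 1) powr - of_real x) = real (2 * k + 1) powr - x" for k
        using powr_of_real[of "real (2 * k + 1)" "- x"] by (simp only: of_real_of_nat_eq of_real_minus) simp
      have "(\<lambda>k. Re (of_nat (2 * k + 1) powr - of_real x)) sums Re (zeta_odd (of_real x))"
        by (rule sums_Re[OF zeta_odd_sums]) (use elim in simp)
      hence S: "(\<lambda>k. real (2 * k + 1) powr - x) sums Re (zeta_odd (of_real x))"
        by (simp only: Re)
      have "(\<Sum>k<N. real (2 * k + 1) powr - x) \<le> Re (zeta_odd (of_real x))"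
        unfolding sums_unique[OF S] by (rule sum_le_suminf[OF sums_summable[OF S]]) auto
      also have "\<dots> \<le> norm (zeta_odd (of_real x))" by (rule complex_Re_le_cmod)
      also have "\<dots> \<le> M" using elim by (intro assms) auto
      finally show ?case .
    qed
  qed simp
  hence "summable (\<lambda>k. 1 / real (2 * k + 1))"
    by (intro bounded_imp_summable[where B = M]) (auto simp only: lessThan_Suc_atMost[symmetric], simp)
  thus False using not_summable_inverse_odd by blast
qed

text \<open>If \<open>L_chi\<close> vanished at \<open>1 + i t\<close>, the two zeros at \<open>s = 1\<close> of \<open>L_chi (s + i t) L_chi (s - i t)\<close> would
  cancel the double pole of \<open>zeta_odd\<^sup>2\<close>, and the series \<open>G\<close> with the nonnegative coefficients
  \<open>|\<Sum>d|n. a\<^sub>d d\<^sup>-\<^sup>i\<^sup>t|\<^sup>2\<close> would continue to \<open>Re s > 1/2\<close>. It is at least \<open>1\<close> there on the real axis,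
  whereas the factor \<open>1 / zeta_odd (2 s)\<close> forces it to vanish at \<open>1/2\<close>.\<close>

theorem L_chi_nonzero:
  assumes "Re z = 1"
  shows "L_chi z \<noteq> 0"
proof
  assume zero: "L_chi z = 0"
  define w where "w = \<i> * complex_of_real (Im z)"
  have zw: "z = 1 + w" "cnj z = 1 - w" and Re_w: "Re w = 0" and cnj_w: "cnj w = - w"
    using assms by (simp_all add: w_def complex_eq_iff)
  have zero': "L_chi (1 - w) = 0"
    using L_chi_cnj[of z] zero assms by (simp only: zw(2)) simp
  define u where "u = (\<lambda>n. of_int (a_seq n) * of_nat n powr - w)"
  define c where "c = (\<lambda>n. norm (\<Sum>d | d dvd n. u d) ^ 2)"
  \<comment> \<open>Subtracting \<open>L_chi (1 + v)\<close> makes the singularity at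
    \<open>1\<close> removable for every \<open>v\<close>. Only because these values vanish for
    \<open>v = w\<close> and \<open>v = - w\<close> does \<open>num\<close> equal
    \<open>zeta_odd s ^ 2 * L_chi (s + w) * L_chi (s - w)\<close> for
    \<open>Re s > 1\<close>.\<close>
  define quot where "quot = (\<lambda>v s. if s = 1 then deriv (\<lambda>s. L_chi (s + v)) 1
      else (L_chi (s + v) - L_chi (1 + v)) / (s - 1))"
  define num where "num = (\<lambda>s. Z_odd s ^ 2 * quot w s * quot (- w) s)"
  \<comment> \<open>This is \<open>num s / zeta_odd (2 * s)\<close>, written through
    \<open>Z_odd\<close> because its holomorphy is already established.\<close>
  define G where "G = (\<lambda>s. num s * (2 * s - 1) / Z_odd (2 * s))"

  have hol_shift: "(\<lambda>s. L_chi (s + v)) holomorphic_on {s. Re s > 0}" if "Re v = 0" for v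
    by (rule holomorphic_on_compose_gen[OF _ holomorphic_L_chi, unfolded o_def])
      (use that in \<open>auto intro!: holomorphic_intros\<close>)
  have hol_quot: "quot v holomorphic_on {s. Re s > 0}" if "Re v = 0" for v
    unfolding quot_def by (rule pole_lemma_open[OF hol_shift[OF that] open_half_plane])
  have hol_num: "num holomorphic_on {s. Re s > 0}"
    unfolding num_def using Re_w
    by (intro holomorphic_on_mult holomorphic_on_power holomorphic_Z_odd hol_quot) auto
  have Z2: "Z_odd (2 * s) = (2 * s - 1) * zeta_odd (2 * s)" "zeta_odd (2 * s) \<noteq> 0" "2 * s - 1 \<noteq> 0"
    if "Re s > 1 / 2" for s
    using that Z_odd_eq[of "2 * s"] zeta_odd_nonzero[of "2 * s"] by (auto simp: complex_eq_iff)
  have hol_G: "G holomorphic_on {s. Re s > 1 / 2}"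
    unfolding G_def
  proof (intro holomorphic_on_divide holomorphic_on_mult)
    show "num holomorphic_on {s. Re s > 1 / 2}"
      by (rule holomorphic_on_subset[OF hol_num]) auto
    show "(\<lambda>s. Z_odd (2 * s)) holomorphic_on {s. Re s > 1 / 2}"
      by (rule holomorphic_on_compose_gen[OF _ holomorphic_Z_odd, unfolded o_def])
        (auto intro!: holomorphic_intros)
    show "Z_odd (2 * s) \<noteq> 0" if "s \<in> {s. Re s > 1 / 2}" for s
      using that Z2[of s] by simp
  qed (auto intro!: holomorphic_intros)
  have G_num: "G s * zeta_odd (2 * s) = num s" if "Re s > 1 / 2" for s
    using Z2[OF that] by (simp add: G_def)

  have u_norm: "norm (u n) = 1" if "n \<in> odds" for n
    using odds_pos[OF that] by (simp add: u_def norm_mult norm_of_nat_powr Re_w)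
  have u_mult: "u (m * n) = u m * u n" if "m \<in> odds" "n \<in> odds" for m n
    using that by (simp add: u_def a_seq_mult odds_def of_nat_mult_powr del: of_nat_mult)
  have G_sums: "(\<lambda>k. of_real (c (2 * k + 1)) * of_nat (2 * k + 1) powr - s) sums G s" if s: "Re s > 1" for s
  proof -
    obtain B where B: "((\<lambda>n. of_real (norm (\<Sum>d | d dvd n. u d) ^ 2) * of_nat n powr - s) has_sum B) odds"
      and eq: "B * (\<Sum>\<^sub>\<infinity>k\<in>odds. of_nat (k ^ 2) powr - s) =
        (\<Sum>\<^sub>\<infinity>n\<in>odds. of_nat n powr - s) ^ 2 * (\<Sum>\<^sub>\<infinity>n\<in>odds. u n * of_nat n powr - s) *
        (\<Sum>\<^sub>\<infinity>n\<in>odds. cnj (u n) * of_nat n powr - s)"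
      by (rule ramanujan_convolution[OF dirichlet_terms_summable[OF s] of_nat_mult_powr u_mult u_norm])
    have "(\<Sum>\<^sub>\<infinity>n\<in>odds. u n * of_nat n powr - s) = L_chi (s + w)"
    proof -
      have "u n * of_nat n powr - s = of_int (a_seq n) * of_nat n powr - (s + w)" for n
        by (simp add: u_def powr_add[symmetric] algebra_simps)
      thus ?thesis using infsum_L_chi[of "s + w"] s Re_w by simp
    qed
    moreover have "(\<Sum>\<^sub>\<infinity>n\<in>odds. cnj (u n) * of_nat n powr - s) = L_chi (s - w)"
    proof -
      have "cnj (u n) * of_nat n powr - s = of_int (a_seq n) * of_nat n powr - (s - w)" for n
        by (simp add: u_def cnj_powr cnj_w powr_add[symmetric])
      thus ?thesis using infsum_L_chi[of "s - w"] s Re_w by simp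
    qed
    ultimately have "B * zeta_odd (2 * s) = zeta_odd s ^ 2 * L_chi (s + w) * L_chi (s - w)"
      using eq by (simp only: of_nat_square_powr zeta_odd_def)
    moreover have "num s = zeta_odd s ^ 2 * L_chi (s + w) * L_chi (s - w)"
    proof -
      have "s \<noteq> 1" using s by auto
      thus ?thesis using zero zero' s
        by (simp add: num_def quot_def Z_odd_eq zw power2_eq_square)
    qed
    ultimately have "B * zeta_odd (2 * s) = G s * zeta_odd (2 * s)"
      using G_num[of s] s by simp
    hence "B = G s" using Z2(2)[of s] s by simp
    thus ?thesis using odds_sums[OF B] by (simp only: c_def)
  qed
  have c1: "c (2 * 0 + 1) = 1"
    by (simp add: c_def u_def)
  have lower: "Re (G (of_real x)) \<ge> 1" if "1 / 2 < x" "x \<le> 2" for x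
    using landau_lower_bound[of "\<lambda>k. c (2 * k + 1)" "\<lambda>k. 2 * k + 1" G "1 / 2" x] hol_G G_sums that c1
    by (simp add: c_def)

  \<comment> \<open>The limit at \<open>1 / 2\<close> in terms of bounds: from
    \<open>G s * zeta_odd (2 * s) = num s\<close> and \<open>|G| \<ge> 1\<close>, a bound for
    \<open>num\<close> on \<open>[1/2, 1]\<close> becomes one for \<open>zeta_odd\<close> on
    \<open>(1, 2]\<close>.\<close>
  have "continuous_on (complex_of_real ` {1/2..1}) num"
    by (rule continuous_on_subset[OF holomorphic_on_imp_continuous_on[OF hol_num]]) auto
  moreover have "compact (complex_of_real ` {1/2..1})"
    by (intro compact_continuous_image continuous_intros) auto
  ultimately have "bounded (num ` complex_of_real ` {1/2..1})"
    by (rule compact_imp_bounded[OF compact_continuous_image])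
  then obtain M where M: "\<And>s. s \<in> complex_of_real ` {1/2..1} \<Longrightarrow> norm (num s) \<le> M"
    unfolding bounded_iff by blast
  have "norm (zeta_odd (of_real x)) \<le> M" if "1 < x" "x \<le> 2" for x
  proof -
    let ?s = "complex_of_real (x / 2)"
    have "1 \<le> norm (G ?s)"
      using lower[of "x / 2"] that complex_Re_le_cmod[of "G ?s"] by linarith
    hence "norm (zeta_odd (of_real x)) \<le> norm (G ?s) * norm (zeta_odd (of_real x))"
      by (simp add: mult_le_cancel_right1)
    also have "\<dots> = norm (num ?s)"
      using G_num[of ?s] that by (simp flip: norm_mult)
    also have "\<dots> \<le> M" using that by (intro M imageI) auto
    finally show ?thesis .
  qed
  thus False by (rule zeta_odd_unbounded)
qed

section \<open>Newman's Tauberian theorem\<close>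

lemma powr_telescope_neg:
  assumes m: "m > 0" and x: "x > 0"
  shows "(m + 1) powr (- x - 1) \<le> (m powr - x - (m + 1) powr - x) / (x :: real)"
proof -
  have "\<exists>\<xi>. m < \<xi> \<and> \<xi> < m + 1 \<and> (m + 1) powr - x - m powr - x = (m + 1 - m) * (- x * \<xi> powr (- x - 1))"
    using m by (intro MVT2) (auto intro!: derivative_eq_intros)
  then obtain \<xi> where \<xi>: "m < \<xi>" "\<xi> < m + 1" and eq: "m powr - x - (m + 1) powr - x = x * \<xi> powr (- x - 1)"
    by auto
  have "(m + 1) powr (- x - 1) \<le> \<xi> powr (- x - 1)"
    using \<xi> m x by (intro powr_mono2') auto
  thus ?thesis unfolding eq using x by simp
qed

text \<open>Comparison with the integral of \<open>t^(x - 1)\<close> over \<open>[0, N + 1]\<close>.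
  The integrand decreases for \<open>x \<le> 1\<close>; for \<open>x > 1\<close> it increases, each
  term is compared with the interval to its right, and the last term is left over.\<close>

lemma sum_powr_le:
  assumes x: "x > 0"
  shows "(\<Sum>n=1..Suc N. real n powr (x - 1)) \<le> real (Suc N) powr x / x + real (Suc N) powr (x - 1)"
proof -
  have mvt: "\<exists>\<xi>. m < \<xi> \<and> \<xi> < m + 1 \<and> (m + 1) powr x - m powr x = x * \<xi> powr (x - 1)" if "m > 0" for m :: real
  proof -
    have "\<exists>\<xi>. m < \<xi> \<and> \<xi> < m + 1 \<and> (m + 1) powr x - m powr x = (m + 1 - m) * (x * \<xi> powr (x - 1))"
      using that by (intro MVT2) (auto intro!: derivative_eq_intros)
    thus ?thesis by simp
  qed
  show ?thesis
  proof (cases "x \<le> 1")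
    case True
    have "(\<Sum>n=1..Suc N. real n powr (x - 1)) \<le> real (Suc N) powr x / x"
    proof (induction N)
      case 0
      thus ?case using x True by (simp add: field_simps)
    next
      case (Suc N)
      obtain \<xi> where \<xi>: "real (Suc N) < \<xi>" "\<xi> < real (Suc N) + 1"
        and eq: "(real (Suc N) + 1) powr x - real (Suc N) powr x = x * \<xi> powr (x - 1)"
        using mvt[of "real (Suc N)"] by auto
      have "(real (Suc N) + 1) powr (x - 1) \<le> \<xi> powr (x - 1)"
        using \<xi> True by (intro powr_mono2') auto
      also have "\<xi> powr (x - 1) = (real (Suc N) + 1) powr x / x - real (Suc N) powr x / x"
        using eq x by (simp add: field_simps)
      finally have "real (Suc (Suc N)) powr (x - 1) \<le> real (Suc (Suc N)) powr x / x - real (Suc N) powr x / x"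
        by (simp add: add.commute)
      thus ?case using Suc by simp
    qed
    thus ?thesis by (smt (verit) powr_ge_zero)
  next
    case False
    show ?thesis
    proof (induction N)
      case 0
      thus ?case using x by simp
    next
      case (Suc N)
      obtain \<xi> where \<xi>: "real (Suc N) < \<xi>" "\<xi> < real (Suc N) + 1"
        and eq: "(real (Suc N) + 1) powr x - real (Suc N) powr x = x * \<xi> powr (x - 1)"
        using mvt[of "real (Suc N)"] by auto
      have "real (Suc N) powr (x - 1) \<le> \<xi> powr (x - 1)"
        using \<xi> False by (intro powr_mono2) auto
      also have "\<xi> powr (x - 1) = (real (Suc N) + 1) powr x / x - real (Suc N) powr x / x"
        using eq x by (simp add: field_simps)
      finally have "real (Suc N) powr (x - 1) \<le> real (Suc (Suc N)) powr x / x - real (Suc N) powr x / x"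
        by (simp add: add.commute)
      thus ?case using Suc by simp
    qed
  qed
qed

text \<open>The right-hand side is the integral of \<open>t^(- Re z - 1)\<close> over
  \<open>[N, \<infinity>)\<close>, obtained by telescoping the mean value estimate.\<close>

lemma dirichlet_tail_bound:
  fixes a :: "nat \<Rightarrow> complex"
  assumes a: "\<And>n. norm (a n) \<le> 1" and x: "Re z > 0" and N: "N > 0"
    and sums: "(\<lambda>n. a n * of_nat n powr - (1 + z)) sums F"
  shows "norm (F - (\<Sum>n\<le>N. a n * of_nat n powr - (1 + z))) \<le> real N powr - Re z / Re z"
proof -
  let ?x = "Re z"
  let ?h = "\<lambda>k. real (k + N) powr - ?x"
  have tail: "F - (\<Sum>n\<le>N. a n * of_nat n powr - (1 + z)) =
      (\<Sum>k. a (k + Suc N) * of_nat (k + Suc N) powr - (1 + z))"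
    using sums_split_initial_segment[OF sums, of "Suc N"] by (simp only: lessThan_Suc_atMost sums_iff)
  have "?h \<longlonglongrightarrow> 0"
  proof -
    have "((\<lambda>t. t powr - ?x) \<longlongrightarrow> 0) at_top"
      using x by (intro tendsto_neg_powr filterlim_ident) auto
    moreover have "filterlim (\<lambda>k. real (k + N)) at_top sequentially" by real_asymp
    ultimately show ?thesis by (rule filterlim_compose)
  qed
  hence "(\<lambda>k. ?h k - ?h (Suc k)) sums (?h 0 - 0)" by (rule telescope_sums')
  hence S: "(\<lambda>k. (?h k - ?h (Suc k)) / ?x) sums (real N powr - ?x / ?x)"
    by (intro sums_divide) simp
  have "norm (a (k + Suc N) * of_nat (k + Suc N) powr - (1 + z)) \<le> (?h k - ?h (Suc k)) / ?x" for k
  proof -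
    have e: "Re (- (1 + z)) = - ?x - 1" by simp
    have "norm (a (k + Suc N) * of_nat (k + Suc N) powr - (1 + z)) \<le> 1 * real (k + Suc N) powr (- ?x - 1)"
      unfolding norm_mult norm_of_nat_powr e using a by (intro mult_mono) auto
    also have "\<dots> \<le> (?h k - ?h (Suc k)) / ?x"
      using powr_telescope_neg[of "real (k + N)" ?x] N x by (simp add: add_ac)
    finally show ?thesis .
  qed
  thus ?thesis unfolding tail sums_unique[OF S] by (rule norm_suminf_le[OF _ sums_summable[OF S]])
qed

lemma dirichlet_partial_sum_bound:
  fixes a :: "nat \<Rightarrow> complex"
  assumes a: "\<And>n. norm (a n) \<le> 1" and x: "Re z < 0" and N: "N > 0"
  shows "norm (\<Sum>n\<le>N. a n * of_nat n powr - (1 + z))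
    \<le> real N powr - Re z / (- Re z) + real N powr (- Re z - 1)"
proof -
  obtain M where M: "N = Suc M" using N gr0_implies_Suc by blast
  have "norm (\<Sum>n\<le>N. a n * of_nat n powr - (1 + z)) \<le> (\<Sum>n\<le>N. real n powr (- Re z - 1))"
  proof (rule sum_norm_le)
    fix n
    have e: "Re (- (1 + z)) = - Re z - 1" by simp
    have "norm (a n * of_nat n powr - (1 + z)) \<le> 1 * real n powr (- Re z - 1)"
      unfolding norm_mult norm_of_nat_powr e using a by (intro mult_mono) auto
    thus "norm (a n * of_nat n powr - (1 + z)) \<le> real n powr (- Re z - 1)" by simp
  qed
  \<comment> \<open>The term \<open>n = 0\<close> vanishes, since \<open>0 powr y = 0\<close> for
    every \<open>y\<close>.\<close>
  also have "\<dots> = (\<Sum>n=1..Suc M. real n powr (- Re z - 1))"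
    unfolding M by (rule sum.mono_neutral_right) (auto simp: Suc_le_eq)
  also have "\<dots> \<le> real N powr - Re z / (- Re z) + real N powr (- Re z - 1)"
    unfolding M using sum_powr_le[of "- Re z" M] x by simp
  finally show ?thesis .
qed

section \<open>Contours for Newman's argument\<close>

abbreviation right_arc :: "real \<Rightarrow> real \<Rightarrow> complex" where
  "right_arc R \<equiv> part_circlepath 0 R (- (pi / 2)) (pi / 2)"

abbreviation left_arc :: "real \<Rightarrow> real \<Rightarrow> complex" where
  "left_arc R \<equiv> part_circlepath 0 R (pi / 2) (3 * pi / 2)"

lemma right_arc_ends: "pathstart (right_arc R) = - (\<i> * of_real R)" "pathfinish (right_arc R) = \<i> * of_real R"
  unfolding pathstart_part_circlepath pathfinish_part_circlepath cis_conv_exp[symmetric]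
  by (simp_all add: complex_eq_iff)

lemma left_arc_ends: "pathstart (left_arc R) = \<i> * of_real R" "pathfinish (left_arc R) = - (\<i> * of_real R)"
  unfolding pathstart_part_circlepath pathfinish_part_circlepath cis_conv_exp[symmetric]
  using cos_3over2_pi sin_3over2_pi by (simp_all add: complex_eq_iff)

lemma right_arcD:
  assumes "w \<in> path_image (right_arc R)" "R > 0"
  shows "norm w = R" "Re w \<ge> 0"
proof -
  show "norm w = R" using in_path_image_part_circlepath[OF assms(1)] assms(2) by simp
  obtain x where x: "w = of_real R * exp (\<i> * of_real x)" "- (pi / 2) \<le> x" "x \<le> pi / 2"
    using assms(1) by (auto simp: path_image_part_circlepath)
  have "cos x \<ge> 0" using x by (intro cos_ge_zero) auto
  thus "Re w \<ge> 0" using assms(2) x(1) by (simp add: Re_exp)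
qed

lemma left_arcD:
  assumes "w \<in> path_image (left_arc R)" "R > 0"
  shows "norm w = R" "Re w \<le> 0"
proof -
  show "norm w = R" using in_path_image_part_circlepath[OF assms(1)] assms(2) by simp
  obtain x where x: "w = of_real R * exp (\<i> * of_real x)" "pi / 2 \<le> x" "x \<le> 3 * pi / 2"
    using assms(1) by (auto simp: path_image_part_circlepath)
  have "cos (x - pi) \<ge> 0" using x by (intro cos_ge_zero) auto
  thus "Re w \<le> 0" using assms(2) x(1) by (simp add: Re_exp mult_nonneg_nonpos)
qed

text \<open>The arc avoids the negative real axis and \<open>B\<close> the positive one, so
  \<open>Ln w\<close> and \<open>Ln (- w)\<close> are primitives of \<open>1 / w\<close> on the two
  pieces. Each piece contributes \<open>i * pi\<close>.\<close>

lemma winding_number_right_arc_join: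
  assumes R: "R > 0" and B: "valid_path B" "pathstart B = \<i> * of_real R" "pathfinish B = - (\<i> * of_real R)"
    and left: "\<forall>w\<in>path_image B. Re w \<le> 0 \<and> w \<noteq> 0"
  shows "winding_number (right_arc R +++ B) 0 = 1"
proof -
  have A: "valid_path (right_arc R)" by simp
  have A0: "0 \<notin> path_image (right_arc R)" using right_arcD[of 0 R] R by auto
  have join: "valid_path (right_arc R +++ B)"
    using A B right_arc_ends by (intro valid_path_join) auto
  have "((\<lambda>w. 1 / w) has_contour_integral (Ln (pathfinish (right_arc R)) - Ln (pathstart (right_arc R)))) (right_arc R)"
  proof (rule contour_integral_primitive[where S = "path_image (right_arc R)"])
    fix w assume w: "w \<in> path_image (right_arc R)"
    hence "w \<notin> \<real>\<^sub>\<le>\<^sub>0" using right_arcD[OF w R] R by (auto simp: complex_nonpos_Reals_iff complex_norm_eq_1_exp cmod_def)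
    thus "(Ln has_field_derivative 1 / w) (at w within path_image (right_arc R))"
      using has_field_derivative_at_within[OF has_field_derivative_Ln] by (simp add: inverse_eq_divide)
  qed (use A in auto)
  moreover have "((\<lambda>w. 1 / w) has_contour_integral (Ln (- pathfinish B) - Ln (- pathstart B))) B"
  proof (rule contour_integral_primitive[where S = "path_image B"])
    fix w assume w: "w \<in> path_image B"
    hence "- w \<notin> \<real>\<^sub>\<le>\<^sub>0" using bspec[OF left w] by (auto simp: complex_nonpos_Reals_iff complex_eq_iff)
    hence "((\<lambda>w. Ln (- w)) has_field_derivative 1 / w) (at w)"
      by (auto intro!: derivative_eq_intros simp: field_simps)
    thus "((\<lambda>w. Ln (- w)) has_field_derivative 1 / w) (at w within path_image B)"
      by (rule has_field_derivative_at_within)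
  qed (use B in auto)
  ultimately have "((\<lambda>w. 1 / w) has_contour_integral
      (Ln (pathfinish (right_arc R)) - Ln (pathstart (right_arc R))) + (Ln (- pathfinish B) - Ln (- pathstart B)))
      (right_arc R +++ B)"
    using A B by (intro has_contour_integral_join) auto
  moreover have "Ln (\<i> * of_real R) = of_real (ln R) + \<i> * of_real pi / 2"
    "Ln (- (\<i> * of_real R)) = of_real (ln R) - \<i> * of_real pi / 2"
    using R Ln_times_of_real[of R \<i>] Ln_times_of_real[of R "- \<i>"]
    by (simp_all add: mult.commute Ln_of_real)
  ultimately have I: "((\<lambda>w. 1 / w) has_contour_integral 2 * pi * \<i>) (right_arc R +++ B)"
    unfolding right_arc_ends B(2,3) by (simp add: algebra_simps)
  have "winding_number (right_arc R +++ B) 0 = 1 / (2 * pi * \<i>) * contour_integral (right_arc R +++ B) (\<lambda>w. 1 / (w - 0))"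
  proof (rule winding_number_valid_path[OF join])
    show "0 \<notin> path_image (right_arc R +++ B)"
      using A0 left B right_arc_ends by (auto simp: path_image_join)
  qed
  thus ?thesis using contour_integral_unique[OF I] by simp
qed

text \<open>The factor \<open>1 + w\<^sup>2 / R\<^sup>2\<close> is Newman's: on \<open>|w| = R\<close> it turns \<open>1 / w\<close> into \<open>2 Re w / R\<^sup>2\<close>, which absorbs
  the \<open>1 / Re w\<close> in the bounds for the tails and the partial sums.\<close>

lemma norm_newman_kernel:
  assumes "norm w = R" "R > 0"
  shows "norm ((1 + w ^ 2 / of_real R ^ 2) / w) = 2 * \<bar>Re w\<bar> / R ^ 2"
proof -
  have w: "w \<noteq> 0" using assms by auto
  have "w * cnj w = of_real R ^ 2"
    using assms by (metis complex_norm_square of_real_power)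
  hence "1 + w ^ 2 / of_real R ^ 2 = w * (cnj w + w) / of_real R ^ 2"
    using assms by (simp add: field_simps power2_eq_square)
  hence "(1 + w ^ 2 / of_real R ^ 2) / w = (cnj w + w) / of_real R ^ 2"
    using w by simp
  also have "cnj w + w = of_real (2 * Re w)" by (simp add: complex_eq_iff)
  finally show ?thesis using assms by (simp add: norm_divide norm_power abs_mult)
qed

text \<open>Along a segment leaving the imaginary axis at an angle, the distance to \<open>p\<close>
  is proportional to \<open>- Re w\<close>. With \<open>y = - Re w * ln N\<close> the inequality
  \<open>y * exp (- y) \<le> 1\<close> then turns the zero at \<open>p\<close> into decay
  \<open>1 / ln N\<close>, uniformly up to the endpoint.\<close>

lemma slanted_segment_bound:
  fixes \<phi> :: "complex \<Rightarrow> complex"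
  assumes \<phi>: "continuous_on (closed_segment p q) \<phi>" and p: "Re p = 0" and q: "Re q < 0"
  obtains C where "\<And>N w. N > 1 \<Longrightarrow> w \<in> closed_segment p q \<Longrightarrow>
    norm (\<phi> w * (w - p) * of_nat N powr w) \<le> C / ln (real N)"
proof -
  have "bounded (\<phi> ` closed_segment p q)"
    by (intro compact_imp_bounded compact_continuous_image \<phi> compact_segment)
  then obtain M where M: "\<And>w. w \<in> closed_segment p q \<Longrightarrow> norm (\<phi> w) \<le> M"
    unfolding bounded_iff by blast
  have M0: "M \<ge> 0" using M[of p] norm_ge_zero[of "\<phi> p"] by (simp del: norm_ge_zero)
  define \<kappa> where "\<kappa> = norm (q - p) / (- Re q)"
  have \<kappa>: "\<kappa> \<ge> 0" unfolding \<kappa>_def using q by (intro divide_nonneg_nonneg) auto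
  show ?thesis
  proof (rule that[of "M * \<kappa>"])
    fix N :: nat and w assume N: "N > 1" and w: "w \<in> closed_segment p q"
    have L: "ln (real N) > 0" using N by simp
    obtain t where t: "w = (1 - t) *\<^sub>R p + t *\<^sub>R q" "0 \<le> t" "t \<le> 1"
      using w by (auto simp: in_segment)
    have Re: "Re w = t * Re q" by (simp add: t p)
    have "w - p = t *\<^sub>R (q - p)" by (simp add: t algebra_simps)
    hence "norm (w - p) = t * norm (q - p)" using t(2) by (simp only: norm_scaleR abs_of_nonneg)
    hence wp: "norm (w - p) = \<kappa> * (- Re w)" unfolding Re \<kappa>_def using q by simp
    define y where "y = - Re w * ln (real N)"
    have "y \<le> exp y" using exp_ge_add_one_self[of y] by linarith
    hence "y * exp (- y) \<le> 1" by (simp add: exp_minus field_simps)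
    hence "(- Re w) * real N powr Re w \<le> 1 / ln (real N)"
      using L N by (simp add: y_def powr_def field_simps)
    hence *: "norm (w - p) * real N powr Re w \<le> \<kappa> * (1 / ln (real N))"
      unfolding wp mult.assoc by (intro mult_left_mono \<kappa>)
    have "norm (\<phi> w * (w - p) * of_nat N powr w) = norm (\<phi> w) * (norm (w - p) * real N powr Re w)"
      by (simp add: norm_mult norm_of_nat_powr)
    also have "\<dots> \<le> M * (\<kappa> * (1 / ln (real N)))"
      by (rule mult_mono[OF M[OF w] * M0]) simp
    finally show "norm (\<phi> w * (w - p) * of_nat N powr w) \<le> M * \<kappa> / ln (real N)" by simp
  qed
qed

lemma slanted_segment_left:
  assumes "w \<in> closed_segment p q" "Re p = 0" "p \<noteq> 0" "Re q < 0"
  shows "Re w \<le> 0" "w \<noteq> 0"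
proof -
  obtain t where t: "w = (1 - t) *\<^sub>R p + t *\<^sub>R q" "0 \<le> t" "t \<le> 1"
    using assms(1) by (auto simp: in_segment)
  have Re: "Re w = t * Re q" using t assms(2) by simp
  show "Re w \<le> 0" unfolding Re using t(2) assms(4) by (intro mult_nonneg_nonpos) auto
  show "w \<noteq> 0"
  proof
    assume "w = 0"
    hence "t = 0" using Re assms(4) by auto
    thus False using t(1) \<open>w = 0\<close> assms(3) by simp
  qed
qed

text \<open>The closing path \<open>B\<close> is left general because two are needed: a slanted path
  staying where \<open>G\<close> is holomorphic, and the left half-circle for the entire partial
  sums.\<close>

lemma right_arc_join_integral:
  assumes R: "R > 0" and B: "valid_path B" "pathstart B = \<i> * of_real R" "pathfinish B = - (\<i> * of_real R)"
    and left: "\<forall>w\<in>path_image B. Re w \<le> 0 \<and> w \<noteq> 0"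
    and T: "convex T" "open T" "0 \<in> T" "path_image (right_arc R) \<subseteq> T" "path_image B \<subseteq> T"
    and f: "f holomorphic_on T"
  shows "(\<lambda>w. f w / w) contour_integrable_on right_arc R" "(\<lambda>w. f w / w) contour_integrable_on B"
    "contour_integral (right_arc R) (\<lambda>w. f w / w) + contour_integral B (\<lambda>w. f w / w) = 2 * pi * \<i> * f 0"
proof -
  have ends: "pathfinish (right_arc R) = pathstart B" using right_arc_ends B by simp
  have "((\<lambda>w. f w / (w - 0)) has_contour_integral
      (2 * pi * \<i> * winding_number (right_arc R +++ B) 0 * f 0)) (right_arc R +++ B)"
  proof (rule Cauchy_integral_formula_convex_simple[OF T(1) f])
    show "0 \<in> interior T" using T by (simp add: interior_open)
    show "valid_path (right_arc R +++ B)" using B ends by (intro valid_path_join) auto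
    show "path_image (right_arc R +++ B) \<subseteq> T - {0}"
      using T left right_arcD(1)[of 0 R] R ends by (auto simp: path_image_join)
    show "pathfinish (right_arc R +++ B) = pathstart (right_arc R +++ B)"
      unfolding pathfinish_join pathstart_join right_arc_ends B(3) ..
  qed
  hence I: "((\<lambda>w. f w / w) has_contour_integral (2 * pi * \<i> * f 0)) (right_arc R +++ B)"
    unfolding winding_number_right_arc_join[OF R B left] by simp
  have int: "(\<lambda>w. f w / w) contour_integrable_on (right_arc R +++ B)"
    using I contour_integrable_on_def by blast
  thus int': "(\<lambda>w. f w / w) contour_integrable_on right_arc R" "(\<lambda>w. f w / w) contour_integrable_on B"
    using B by (auto simp: contour_integrable_join)
  show "contour_integral (right_arc R) (\<lambda>w. f w / w) + contour_integral B (\<lambda>w. f w / w) = 2 * pi * \<i> * f 0"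
    using contour_integral_join[OF int' _ B(1)] contour_integral_unique[OF I] by simp
qed

text \<open>Compactness of a segment of the imaginary axis gives a uniform margin
  \<open>\<epsilon>\<close> to its left. A truncated half-plane of that margin is convex, as the
  Cauchy formula used here demands; height \<open>R + 1\<close> leaves room for the endpoints of the
  arc.\<close>

lemma half_disc_neighbourhood:
  assumes V: "open V" "{z. Re z \<ge> 0} \<subseteq> V" and R: "R > 0"
  obtains T \<delta> where "convex T" "open T" "T \<subseteq> V" "\<delta> > 0" "- complex_of_real \<delta> \<in> T"
    "\<And>w. norm w \<le> R \<Longrightarrow> Re w \<ge> 0 \<Longrightarrow> w \<in> T"
proof -
  let ?K = "closed_segment (- (\<i> * of_real (R + 1))) (\<i> * of_real (R + 1))"
  have "?K \<subseteq> V"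
  proof
    fix w assume "w \<in> ?K"
    hence "Re w = 0" by (auto simp: in_segment)
    thus "w \<in> V" using V by auto
  qed
  then obtain \<epsilon> where \<epsilon>: "\<epsilon> > 0" "(\<Union>x\<in>?K. ball x \<epsilon>) \<subseteq> V"
    using compact_subset_open_imp_ball_epsilon_subset[OF compact_segment V(1)] by metis
  define T where "T = {z. Re z > - \<epsilon>} \<inter> {z. Im z < R + 1} \<inter> {z. Im z > - (R + 1)}"
  have sub: "T \<subseteq> V"
  proof
    fix z assume z: "z \<in> T"
    show "z \<in> V"
    proof (cases "Re z \<ge> 0")
      case True
      thus ?thesis using V by auto
    next
      case False
      define t where "t = (Im z / (R + 1) + 1) / 2"
      have t: "0 \<le> t" "t \<le> 1" "(2 * t - 1) * (R + 1) = Im z"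
        using z R by (auto simp: t_def T_def field_simps)
      have "\<i> * of_real (Im z) \<in> ?K"
        unfolding in_segment
        by (rule exI[of _ t]) (use t in \<open>simp add: complex_eq_iff algebra_simps\<close>)
      moreover have "z \<in> ball (\<i> * of_real (Im z)) \<epsilon>"
      proof -
        have "\<i> * of_real (Im z) - z = of_real (- Re z)" by (simp add: complex_eq_iff)
        hence "dist (\<i> * of_real (Im z)) z = \<bar>Re z\<bar>" by (simp only: dist_norm norm_of_real)
        thus ?thesis using z False by (simp add: T_def)
      qed
      ultimately show ?thesis using \<epsilon> by blast
    qed
  qed
  show ?thesis
  proof (rule that[of T "\<epsilon> / 2"])
    show "convex T" unfolding T_def
      by (intro convex_Int convex_halfspace_Re_gt convex_halfspace_Im_lt convex_halfspace_Im_gt)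
    show "open T" unfolding T_def
      by (intro open_Int open_halfspace_Re_gt open_halfspace_Im_lt open_halfspace_Im_gt)
    show "w \<in> T" if "norm w \<le> R" "Re w \<ge> 0" for w
      using that \<epsilon> abs_Im_le_cmod[of w] by (auto simp: T_def)
  qed (use \<epsilon> sub R in \<open>auto simp: T_def\<close>)
qed

text \<open>After division by \<open>2 * pi\<close>, the tail on the right arc contributes
  \<open>1 / R\<close>, the partial sum on the left arc \<open>1 / R + 1 / N\<close>, and
  \<open>G\<close> on the slanted path \<open>C / ln N\<close>, where \<open>C\<close> may depend on
  \<open>R\<close>.\<close>

lemma newman_estimate:
  fixes a :: "nat \<Rightarrow> complex" and G :: "complex \<Rightarrow> complex"
  assumes a: "\<And>n. norm (a n) \<le> 1"
    and V: "open V" "{z. Re z \<ge> 0} \<subseteq> V" and G: "G holomorphic_on V"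
    and sums: "\<And>z. Re z > 0 \<Longrightarrow> (\<lambda>n. a n * of_nat n powr - (1 + z)) sums G z"
    and R: "R > 0"
  obtains C where "\<And>N. N > 1 \<Longrightarrow>
    norm (G 0 - (\<Sum>n\<le>N. a n * of_nat n powr - 1)) \<le> 2 / R + 1 / real N + C / ln (real N)"
proof -
  obtain T \<delta> where T: "convex T" "open T" "T \<subseteq> V" and \<delta>: "\<delta> > 0" "- complex_of_real \<delta> \<in> T"
    and disc: "\<And>w. norm w \<le> R \<Longrightarrow> Re w \<ge> 0 \<Longrightarrow> w \<in> T"
    using half_disc_neighbourhood[OF V R] by metis
  define p where "p = \<i> * complex_of_real R"
  define q where "q = - complex_of_real \<delta>"
  define B where "B = linepath p q +++ linepath q (- p)"
  have pq: "Re p = 0" "Re (- p) = 0" "p \<noteq> 0" "- p \<noteq> 0" "Re q < 0" "norm p = R" "p ^ 2 = - (of_real R ^ 2)"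
    using R \<delta> by (auto simp: p_def q_def norm_mult power_mult_distrib)
  have pqT: "p \<in> T" "- p \<in> T" "q \<in> T" "0 \<in> T"
    using disc[of p] disc[of "- p"] disc[of 0] pq R \<delta> by (auto simp: q_def)
  have seg: "closed_segment p q \<subseteq> T" "closed_segment (- p) q \<subseteq> T"
    using closed_segment_subset T(1) pqT by blast+
  have B: "valid_path B" "pathstart B = \<i> * of_real R" "pathfinish B = - (\<i> * of_real R)"
    by (auto simp: B_def p_def intro!: valid_path_join)
  have B_image: "path_image B = closed_segment p q \<union> closed_segment (- p) q"
    by (simp add: B_def path_image_join closed_segment_commute)
  have B_left: "\<forall>w\<in>path_image B. Re w \<le> 0 \<and> w \<noteq> 0"
    using slanted_segment_left[of _ p q] slanted_segment_left[of _ "- p" q] pq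
    unfolding B_image by blast
  have B_T: "path_image B \<subseteq> T" using seg by (simp add: B_image)
  have A_T: "path_image (right_arc R) \<subseteq> T"
    using right_arcD R disc by (metis order_refl subsetI)
  have D_left: "\<forall>w\<in>path_image (left_arc R). Re w \<le> 0 \<and> w \<noteq> 0"
    using left_arcD[OF _ R] R by fastforce

  define S where "S = (\<lambda>N z. \<Sum>n\<le>N. a n * of_nat n powr - (1 + z))"
  define K where "K = (\<lambda>w. (1 + w ^ 2 / complex_of_real R ^ 2))"
  define fG where "fG = (\<lambda>N w. G w * of_nat N powr w * K w)"
  define fS where "fS = (\<lambda>N w. S N w * of_nat N powr w * K w)"
  have hol_S: "S N holomorphic_on UNIV" for N
    unfolding S_def by (intro holomorphic_intros)
  have hol_fS: "fS N holomorphic_on UNIV" if "N > 1" for N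
    unfolding fS_def K_def using that by (intro holomorphic_intros hol_S) auto
  have hol_fG: "fG N holomorphic_on T" if "N > 1" for N
    unfolding fG_def K_def using that R
    by (intro holomorphic_intros holomorphic_on_subset[OF G T(3)]) auto
  have K_norm: "norm (K w / w) = 2 * \<bar>Re w\<bar> / R ^ 2" if "norm w = R" for w
    unfolding K_def using norm_newman_kernel[OF that R] by simp
  \<comment> \<open>The arc bounds divide by \<open>Re w\<close>, so \<open>p\<close> and
    \<open>- p\<close> are excluded; two points do not affect the integrals.\<close>
  have Re_nonzero: "Re w \<noteq> 0" if "norm w = R" "w \<notin> {p, - p}" for w
  proof
    assume "Re w = 0"
    hence "w = \<i> * of_real (Im w)" "\<bar>Im w\<bar> = R" using that(1) by (auto simp: complex_eq_iff cmod_def)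
    thus False using that(2) by (auto simp: p_def abs_if split: if_splits)
  qed

  have bound_A: "norm (fG N w / w - fS N w / w) \<le> 2 / R ^ 2"
    if N: "N > 1" and w: "w \<in> path_image (right_arc R) - {p, - p}" for N w
  proof -
    have w': "norm w = R" "Re w > 0"
      using right_arcD[of w R] Re_nonzero[of w] w R by (auto simp: less_le)
    have "norm (fG N w / w - fS N w / w) = norm ((G w - S N w) * of_nat N powr w * (K w / w))"
      by (simp add: fG_def fS_def algebra_simps diff_divide_distrib)
    also have "\<dots> = norm (G w - S N w) * real N powr Re w * (2 * Re w / R ^ 2)"
      unfolding norm_mult norm_of_nat_powr K_norm[OF w'(1)] using w' by simp
    also have "\<dots> \<le> (real N powr - Re w / Re w) * real N powr Re w * (2 * Re w / R ^ 2)"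
      unfolding S_def using dirichlet_tail_bound[OF a w'(2) _ sums[OF w'(2)], of N] N w'
      by (intro mult_right_mono) auto
    also have "\<dots> = 2 / R ^ 2"
      using w' N by (simp add: powr_minus field_simps)
    finally show ?thesis .
  qed
  have bound_D: "norm (fS N w / w) \<le> 2 / R ^ 2 + 2 / (real N * R)"
    if N: "N > 1" and w: "w \<in> path_image (left_arc R) - {p, - p}" for N w
  proof -
    define x where "x = - Re w"
    have w': "norm w = R" "Re w < 0"
      using left_arcD[of w R] Re_nonzero[of w] w R by (auto simp: less_le)
    have x: "x > 0" "x \<le> R"
      using w' abs_Re_le_cmod[of w] by (auto simp: x_def)
    have b: "norm (S N w) \<le> real N powr x / x + real N powr (x - 1)"
      using dirichlet_partial_sum_bound[where a = a, OF a w'(2), of N] N by (simp add: S_def x_def)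
    have "norm (fS N w / w) = norm (S N w * of_nat N powr w * (K w / w))"
      by (simp add: fS_def)
    also have "\<dots> = norm (S N w) * real N powr - x * (2 * x / R ^ 2)"
      unfolding norm_mult norm_of_nat_powr K_norm[OF w'(1)] using w' by (simp add: x_def)
    also have "\<dots> \<le> (real N powr x / x + real N powr (x - 1)) * real N powr - x * (2 * x / R ^ 2)"
      using x by (intro mult_right_mono b) auto
    also have "\<dots> = (real N powr x * real N powr - x / x + real N powr (x - 1) * real N powr - x) * (2 * x / R ^ 2)"
      by (simp add: algebra_simps)
    also have "\<dots> = (1 / x + 1 / real N) * (2 * x / R ^ 2)"
      unfolding powr_add[symmetric] using N by (simp add: powr_minus_divide)
    also have "\<dots> = 2 / R ^ 2 + 2 * x / (real N * R ^ 2)"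
      using x N by (simp add: field_simps)
    also have "2 * x / (real N * R ^ 2) \<le> 2 * R / (real N * R ^ 2)"
      using x N by (intro divide_right_mono) auto
    also have "2 * R / (real N * R ^ 2) = 2 / (real N * R)"
      using R by (simp add: power2_eq_square)
    finally show ?thesis by simp
  qed

  \<comment> \<open>The kernel factors as \<open>(w + r) * (w - r) / R ^ 2\<close> for
    \<open>r = p\<close> and \<open>r = - p\<close>. \<open>\<phi> r\<close> collects everything
    except \<open>w - r\<close> and the power of \<open>N\<close>.\<close>
  define \<phi> where "\<phi> = (\<lambda>p w. G w * (w + p) / (of_real R ^ 2 * w))"
  have fG_seg: "fG N w / w = \<phi> r w * (w - r) * of_nat N powr w"
    if "r = p \<or> r = - p" "w \<noteq> 0" for N r w
  proof -
    have "r ^ 2 = - (of_real R ^ 2)" using that pq(7) by auto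
    hence "(w + r) * (w - r) = w ^ 2 + of_real R ^ 2"
      by (simp add: algebra_simps power2_eq_square)
    hence "K w = (w + r) * (w - r) / of_real R ^ 2"
      unfolding K_def using R by (simp add: field_simps)
    thus ?thesis using that R by (simp add: fG_def \<phi>_def)
  qed
  have \<phi>: "continuous_on (closed_segment r q) (\<phi> r)" if r: "r = p \<or> r = - p" for r
  proof -
    have "closed_segment r q \<subseteq> V" using r seg T by auto
    hence "continuous_on (closed_segment r q) G"
      using holomorphic_on_imp_continuous_on[OF G] continuous_on_subset by blast
    moreover have "w \<noteq> 0" if "w \<in> closed_segment r q" for w
      using slanted_segment_left(2)[OF that] r pq by auto
    ultimately show ?thesis unfolding \<phi>_def using R by (intro continuous_intros) auto
  qed
  have "\<exists>C. \<forall>N w. N > 1 \<longrightarrow> w \<in> closed_segment r q \<longrightarrow> norm (fG N w / w) \<le> C / ln (real N)"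
    if r: "r = p \<or> r = - p" for r
  proof -
    have r': "Re r = 0" "r \<noteq> 0" using r pq by auto
    show ?thesis
    proof (rule slanted_segment_bound[OF \<phi>[OF r] r'(1) pq(5)])
      fix C
      assume "\<And>N w. N > 1 \<Longrightarrow> w \<in> closed_segment r q \<Longrightarrow>
        norm (\<phi> r w * (w - r) * of_nat N powr w) \<le> C / ln (real N)"
      thus ?thesis
        using fG_seg[OF r] slanted_segment_left(2)[OF _ r' pq(5)] by (intro exI[of _ C]) auto
    qed
  qed
  then obtain C1 C2 where
    C1: "\<And>N w. N > 1 \<Longrightarrow> w \<in> closed_segment p q \<Longrightarrow> norm (fG N w / w) \<le> C1 / ln (real N)" and
    C2: "\<And>N w. N > 1 \<Longrightarrow> w \<in> closed_segment (- p) q \<Longrightarrow> norm (fG N w / w) \<le> C2 / ln (real N)"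
    by metis

  define l where "l = norm (q - p)"
  show ?thesis
  proof (rule that[of "(C1 * l + C2 * norm (- p - q)) / (2 * pi)"])
    fix N :: nat assume N: "N > 1"
    let ?A = "right_arc R" and ?D = "left_arc R"
    let ?g = "\<lambda>w. fG N w / w" and ?s = "\<lambda>w. fS N w / w"
    note IG = right_arc_join_integral[OF R B B_left T(1,2) pqT(4) A_T B_T hol_fG[OF N]]
    note IS = right_arc_join_integral[OF R valid_path_part_circlepath left_arc_ends D_left
        convex_UNIV open_UNIV UNIV_I subset_UNIV subset_UNIV hol_fS[OF N]]
    have zero: "fG N 0 = G 0" "fS N 0 = S N 0"
      using N by (simp_all add: fG_def fS_def K_def)
    have diff: "contour_integral ?A (\<lambda>w. ?g w - ?s w) = contour_integral ?A ?g - contour_integral ?A ?s"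
      by (rule contour_integral_diff[OF IG(1) IS(1)])
    have "2 * pi * \<i> * (G 0 - S N 0) = 2 * pi * \<i> * G 0 - 2 * pi * \<i> * S N 0"
      by (rule right_diff_distrib)
    also have "\<dots> = (contour_integral ?A ?g + contour_integral B ?g)
        - (contour_integral ?A ?s + contour_integral ?D ?s)"
      unfolding IG(3) IS(3) zero ..
    also have "\<dots> = contour_integral ?A (\<lambda>w. ?g w - ?s w) + contour_integral B ?g - contour_integral ?D ?s"
      unfolding diff by (simp only: algebra_simps)
    finally have "norm (2 * pi * \<i> * (G 0 - S N 0)) = norm (contour_integral ?A (\<lambda>w. ?g w - ?s w)
        + contour_integral B ?g - contour_integral ?D ?s)"
      by (rule arg_cong)
    moreover have "norm (2 * pi * \<i> * (G 0 - S N 0)) = 2 * pi * norm (G 0 - S N 0)"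
      by (simp add: norm_mult)
    ultimately have "2 * pi * norm (G 0 - S N 0) = norm (contour_integral ?A (\<lambda>w. ?g w - ?s w)
        + contour_integral B ?g - contour_integral ?D ?s)"
      by (simp only:)
    also have "\<dots> \<le> norm (contour_integral ?A (\<lambda>w. ?g w - ?s w)) + norm (contour_integral B ?g)
        + norm (contour_integral ?D ?s)"
      by norm
    also have "norm (contour_integral ?A (\<lambda>w. ?g w - ?s w)) \<le> 2 / R ^ 2 * R * (pi / 2 - - (pi / 2))"
      by (rule has_contour_integral_bound_part_circlepath_strong[where k = "{p, - p}",
          OF has_contour_integral_integral[OF contour_integrable_diff[OF IG(1) IS(1)]]])
        (use R bound_A[OF N] in auto)
    also have "norm (contour_integral ?D ?s) \<le> (2 / R ^ 2 + 2 / (real N * R)) * R * (3 * pi / 2 - pi / 2)"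
      by (rule has_contour_integral_bound_part_circlepath_strong[where k = "{p, - p}",
          OF has_contour_integral_integral[OF IS(2)]])
        (use R bound_D[OF N] in auto)
    also have "norm (contour_integral B ?g) \<le> C1 / ln (real N) * l + C2 / ln (real N) * norm (- p - q)"
    proof -
      have int: "?g contour_integrable_on linepath p q" "?g contour_integrable_on linepath q (- p)"
        using IG(2) by (auto simp: B_def contour_integrable_join)
      have eq: "contour_integral B ?g = contour_integral (linepath p q) ?g + contour_integral (linepath q (- p)) ?g"
        unfolding B_def by (rule contour_integral_join[OF int]) auto
      moreover have "norm (contour_integral (linepath p q) ?g) \<le> C1 / ln (real N) * norm (q - p)"
      proof (rule contour_integral_bound_linepath[OF int(1)])
        show "0 \<le> C1 / ln (real N)" using order_trans[OF norm_ge_zero C1[OF N, of p]] by simp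
      qed (use C1[OF N] in auto)
      moreover have "norm (contour_integral (linepath q (- p)) ?g) \<le> C2 / ln (real N) * norm (- p - q)"
      proof (rule contour_integral_bound_linepath[OF int(2)])
        show "0 \<le> C2 / ln (real N)" using order_trans[OF norm_ge_zero C2[OF N, of "- p"]] by simp
      qed (use C2[OF N] in \<open>auto simp: closed_segment_commute\<close>)
      ultimately show ?thesis unfolding eq l_def by (intro norm_triangle_mono)
    qed
    finally have "2 * pi * norm (G 0 - S N 0) \<le> 2 / R ^ 2 * R * (pi / 2 - - (pi / 2))
        + (C1 / ln (real N) * l + C2 / ln (real N) * norm (- p - q))
        + (2 / R ^ 2 + 2 / (real N * R)) * R * (3 * pi / 2 - pi / 2)"
      by simp
    also have "\<dots> = 2 * pi * (2 / R + 1 / real N + (C1 * l + C2 * norm (- p - q)) / (2 * pi) / ln (real N))"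
    proof -
      have "ln (real N) \<noteq> 0" using N by simp
      thus ?thesis using R N by (simp add: field_simps power2_eq_square)
    qed
    finally have "norm (G 0 - S N 0) \<le>
        2 / R + 1 / real N + (C1 * l + C2 * norm (- p - q)) / (2 * pi) / ln (real N)"
      by (rule mult_left_le_imp_le) simp
    thus "norm (G 0 - (\<Sum>n\<le>N. a n * of_nat n powr - 1))
        \<le> 2 / R + 1 / real N + (C1 * l + C2 * norm (- p - q)) / (2 * pi) / ln (real N)"
      by (simp add: S_def)
  qed
qed

theorem newman_tauberian:
  fixes a :: "nat \<Rightarrow> complex" and F :: "complex \<Rightarrow> complex"
  assumes a: "\<And>n. norm (a n) \<le> 1"
    and U: "open U" "{s. Re s \<ge> 1} \<subseteq> U" and F: "F holomorphic_on U"
    and sums: "\<And>s. Re s > 1 \<Longrightarrow> (\<lambda>n. a n * of_nat n powr - s) sums F s"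
  shows "(\<lambda>n. a n * of_nat n powr - 1) sums F 1"
proof -
  define V where "V = (+) 1 -` U"
  have V: "open V" "{z. Re z \<ge> 0} \<subseteq> V"
    unfolding V_def using U(1) subsetD[OF U(2), of "1 + _"]
    by (auto intro!: continuous_open_vimage continuous_intros)
  have G: "(\<lambda>z. F (1 + z)) holomorphic_on V"
    by (rule holomorphic_on_compose_gen[OF _ F, unfolded o_def])
      (auto simp: V_def intro!: holomorphic_intros)
  have "(\<lambda>N. \<Sum>n\<le>N. a n * of_nat n powr - 1) \<longlonglongrightarrow> F 1"
  proof (rule LIMSEQ_I)
    fix e :: real assume e: "e > 0"
    \<comment> \<open>With \<open>R = 4 / e\<close> the term \<open>2 / R\<close> is
      \<open>e / 2\<close>; for this fixed \<open>R\<close> the other two tend to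
      \<open>0\<close>.\<close>
    obtain C where C: "\<And>N. N > 1 \<Longrightarrow> norm (F (1 + 0) - (\<Sum>n\<le>N. a n * of_nat n powr - 1))
        \<le> 2 / (4 / e) + 1 / real N + C / ln (real N)"
      using newman_estimate[OF a V G sums, of "4 / e"] e by auto
    have "(\<lambda>N. 2 / (4 / e) + 1 / real N + C / ln (real N)) \<longlonglongrightarrow> e / 2"
      by real_asymp
    hence "\<forall>\<^sub>F N in sequentially. 2 / (4 / e) + 1 / real N + C / ln (real N) < e"
      by (rule order_tendstoD) (use e in simp)
    with eventually_gt_at_top[of 1]
    have "\<forall>\<^sub>F N in sequentially. norm ((\<Sum>n\<le>N. a n * of_nat n powr - 1) - F 1) < e"
    proof eventually_elim
      case (elim N)
      thus ?case using C[of N] by (simp add: norm_minus_commute)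
    qed
    thus "\<exists>N0. \<forall>N\<ge>N0. norm ((\<Sum>n\<le>N. a n * of_nat n powr - 1) - F 1) < e"
      by (simp add: eventually_sequentially)
  qed
  thus ?thesis by (simp add: sums_def_le)
qed

section \<open>The two series and their product\<close>

lemma a_seq_terms_summable:
  assumes "Re s > 1"
  shows "(\<lambda>n. norm (of_int (a_seq n) * of_nat n powr - s :: complex)) summable_on odds"
  by (intro summable_norm_unimodular_mult dirichlet_terms_summable assms) simp

lemma L_chi_has_sum:
  assumes "Re s > 1"
  shows "((\<lambda>n. of_int (a_seq n) * of_nat n powr - s) has_sum L_chi s) odds"
  using has_sum_infsum[OF abs_summable_summable[OF a_seq_terms_summable[OF assms]]]
  by (simp only: infsum_L_chi[OF assms])

text \<open>The product formula also shows \<open>L_chi s \<noteq> 0\<close> for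
  \<open>Re s > 1\<close>, since its right-hand side has no zero there; this licenses the
  quotient.\<close>

lemma alpha_seq_dirichlet_series:
  assumes s: "Re s > 1"
  shows "L_chi s * (\<Sum>\<^sub>\<infinity>n\<in>odds. of_int (alpha_seq n) * of_nat n powr - s) = zeta_odd (2 * s)"
    and "L_chi s \<noteq> 0"
    and "((\<lambda>n. of_int (alpha_seq n) * of_nat n powr - s) has_sum zeta_odd (2 * s) / L_chi s) odds"
proof -
  let ?f = "\<lambda>n. of_int (a_seq n) * of_nat n powr - s :: complex"
  let ?g = "\<lambda>n. of_int (alpha_seq n) * of_nat n powr - s :: complex"
  have mult: "?f (m * n) = ?f m * ?f n" if "m \<in> odds" "n \<in> odds" for m n
    using that by (simp add: a_seq_mult odds_def of_nat_mult_powr del: of_nat_mult)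
  have sq: "?f (k ^ 2) = of_nat k powr - (2 * s)" if "k \<in> odds" for k
  proof -
    have "a_seq (k ^ 2) = 1"
      using that a_seq_mult[of k k] by (simp add: odds_def power2_eq_square a_seq_def flip: power_add)
    thus ?thesis by (simp add: of_nat_square_powr del: of_nat_power)
  qed
  have g: "of_int (liouville n) * ?f n = ?g n" if "n \<in> odds" for n
    using that by (simp add: alpha_seq_eq odds_def)
  have "infsum ?f odds * (\<Sum>\<^sub>\<infinity>n\<in>odds. of_int (liouville n) * ?f n) = (\<Sum>\<^sub>\<infinity>k\<in>odds. ?f (k ^ 2))"
    by (rule infsumI[OF liouville_convolution[OF a_seq_terms_summable[OF s] mult], symmetric])
  also have "(\<Sum>\<^sub>\<infinity>k\<in>odds. ?f (k ^ 2)) = zeta_odd (2 * s)"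
    unfolding zeta_odd_def by (rule infsum_cong[OF sq])
  also have "(\<Sum>\<^sub>\<infinity>n\<in>odds. of_int (liouville n) * ?f n) = (\<Sum>\<^sub>\<infinity>n\<in>odds. ?g n)"
    by (rule infsum_cong[OF g])
  finally show prod: "L_chi s * (\<Sum>\<^sub>\<infinity>n\<in>odds. ?g n) = zeta_odd (2 * s)"
    by (simp only: infsum_L_chi[OF s])
  show nz: "L_chi s \<noteq> 0" using prod zeta_odd_nonzero[of "2 * s"] s by auto
  have "(\<lambda>n. norm (of_int (liouville n) * ?f n)) summable_on odds"
    by (intro summable_norm_unimodular_mult a_seq_terms_summable s) simp
  hence "(\<lambda>n. of_int (liouville n) * ?f n) summable_on odds"
    by (rule abs_summable_summable)
  also have "?this \<longleftrightarrow> ?g summable_on odds" by (rule summable_on_cong[OF g])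
  finally have "?g summable_on odds" .
  moreover have "infsum ?g odds = zeta_odd (2 * s) / L_chi s"
    using prod nz by (simp add: field_simps)
  ultimately show "(?g has_sum zeta_odd (2 * s) / L_chi s) odds"
    using has_sum_infsum by metis
qed

lemma alpha_seq_series_at_1:
  "(\<lambda>k. of_int (alpha_seq (2 * k + 1)) / of_nat (2 * k + 1)) sums (zeta_odd 2 / L_chi 1)"
proof -
  define F where "F = (\<lambda>s. Z_odd (2 * s) / ((2 * s - 1) * L_chi s))"
  define U where "U = {s. Re s > 1 / 2} \<inter> L_chi -` (- {0})"
  \<comment> \<open>Extension by \<open>0\<close> to even indices fits the series to the Tauberian
    theorem, which runs over all naturals. Pairing consecutive terms removes the zeros again
    afterwards.\<close>
  define a where "a = (\<lambda>n. if n \<in> odds then complex_of_int (alpha_seq n) else 0)"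
  have "open U"
    unfolding U_def
  proof (rule continuous_open_preimage)
    show "continuous_on {s. Re s > 1 / 2} L_chi"
      by (rule continuous_on_subset[OF holomorphic_on_imp_continuous_on[OF holomorphic_L_chi]]) auto
    show "open {s. Re s > 1 / 2}" by (rule open_half_plane)
  qed (simp add: open_Compl)
  moreover have "{s. Re s \<ge> 1} \<subseteq> U"
  proof
    fix s assume "s \<in> {s. Re s \<ge> 1}"
    hence "Re s = 1 \<or> Re s > 1" by auto
    thus "s \<in> U" using L_chi_nonzero[of s] alpha_seq_dirichlet_series(2)[of s] by (auto simp: U_def)
  qed
  moreover have "F holomorphic_on U"
    unfolding F_def
  proof (intro holomorphic_on_divide holomorphic_on_mult)
    show "(\<lambda>s. Z_odd (2 * s)) holomorphic_on U"
      by (rule holomorphic_on_compose_gen[OF _ holomorphic_Z_odd, unfolded o_def])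
        (auto simp: U_def intro!: holomorphic_intros)
    show "L_chi holomorphic_on U"
      by (rule holomorphic_on_subset[OF holomorphic_L_chi]) (auto simp: U_def)
    show "(2 * s - 1) * L_chi s \<noteq> 0" if "s \<in> U" for s
    proof -
      have "2 * s - 1 \<noteq> 0" using that by (auto simp: U_def complex_eq_iff)
      thus ?thesis using that by (simp add: U_def)
    qed
  qed (auto intro!: holomorphic_intros)
  moreover have "norm (a n) \<le> 1" for n
    by (simp add: a_def alpha_seq_eq odds_def norm_mult)
  moreover have F: "F s = zeta_odd (2 * s) / L_chi s" if "Re s \<ge> 1" for s
  proof -
    have "2 * s - 1 \<noteq> 0" using that by (auto simp: complex_eq_iff)
    thus ?thesis using that by (simp add: F_def Z_odd_eq)
  qed
  moreover have "(\<lambda>n. a n * of_nat n powr - s) sums F s" if s: "Re s > 1" for s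
  proof -
    have "((\<lambda>n. of_int (alpha_seq n) * of_nat n powr - s) has_sum F s) odds"
      using alpha_seq_dirichlet_series(3)[OF s] F[of s] s by simp
    hence "((\<lambda>n. a n * of_nat n powr - s) has_sum F s) UNIV"
      by (rule has_sum_cong_neutral[THEN iffD1, rotated -1]) (auto simp: a_def)
    thus ?thesis by (rule has_sum_imp_sums)
  qed
  ultimately have "(\<lambda>n. a n * of_nat n powr - 1) sums F 1"
    by (intro newman_tauberian)
  from sums_pairs[OF this]
  have "(\<lambda>k. a (2 * k) * of_nat (2 * k) powr - 1 + a (2 * k + 1) * of_nat (2 * k + 1) powr - 1) sums F 1" .
  moreover have "a (2 * k) * of_nat (2 * k) powr - 1 + a (2 * k + 1) * of_nat (2 * k + 1) powr - 1 =
      of_int (alpha_seq (2 * k + 1)) / of_nat (2 * k + 1)" for k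
  proof -
    have "a (2 * k) = 0" "a (2 * k + 1) = of_int (alpha_seq (2 * k + 1))"
      by (simp_all add: a_def odds_def)
    moreover have "of_nat n powr - 1 = inverse (of_nat n :: complex)" for n
      by (simp add: powr_minus)
    ultimately show ?thesis
      by (simp only: mult_zero_left add_0_left divide_inverse)
  qed
  moreover have "F 1 = zeta_odd 2 / L_chi 1" using F[of 1] by simp
  ultimately show ?thesis by (simp only:)
qed

text \<open>\<open>L_chi\<close> sums paired terms, so convergence in the original order comes from
  Leibniz's criterion; pairing then keeps the sum.\<close>

lemma L_chi_1:
  "summable (\<lambda>k. (- 1) ^ k / real (2 * k + 1))"
  "L_chi 1 = of_real (\<Sum>k. (- 1) ^ k / real (2 * k + 1))"
proof -
  have "summable (\<lambda>k. (- 1) ^ k * (1 / real (2 * k + 1)))"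
  proof (rule summable_Leibniz(1))
    show "(\<lambda>k. 1 / real (2 * k + 1)) \<longlonglongrightarrow> 0" by real_asymp
    show "monoseq (\<lambda>k. 1 / real (2 * k + 1))"
      by (rule decseq_imp_monoseq) (auto simp: decseq_def intro!: divide_left_mono)
  qed
  thus *: "summable (\<lambda>k. (- 1) ^ k / real (2 * k + 1))" by simp
  from sums_of_real[OF sums_pairs[OF summable_sums[OF *]], where 'a = complex]
  have "(\<lambda>k. of_nat (4 * k + 1) powr - 1 - of_nat (4 * k + 3) powr - 1) sums
      complex_of_real (\<Sum>k. (- 1) ^ k / real (2 * k + 1))"
    by (simp add: powr_minus divide_inverse algebra_simps)
  thus "L_chi 1 = of_real (\<Sum>k. (- 1) ^ k / real (2 * k + 1))"
    by (simp only: L_chi_def sums_iff)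
qed

lemma zeta_odd_2:
  "summable (\<lambda>k. 1 / real (2 * k + 1) ^ 2)"
  "zeta_odd 2 = of_real (\<Sum>k. 1 / real (2 * k + 1) ^ 2)"
proof -
  have "of_nat n powr - 2 = complex_of_real (1 / real n ^ 2)" for n
    by (simp add: powr_minus divide_inverse)
  with zeta_odd_sums[of 2]
  have *: "(\<lambda>k. complex_of_real (1 / real (2 * k + 1) ^ 2)) sums zeta_odd 2"
    by (simp only:) simp
  thus s: "summable (\<lambda>k. 1 / real (2 * k + 1) ^ 2)"
    using summable_complex_of_real sums_summable by blast
  show "zeta_odd 2 = of_real (\<Sum>k. 1 / real (2 * k + 1) ^ 2)"
    using sums_of_real[OF summable_sums[OF s]] * by (rule sums_unique2[symmetric])
qed

theorem theorem1p1:
  shows "(\<forall>s::complex. Re s > 1 \<longrightarrow>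
      summable (\<lambda>k. of_int (a_seq (2 * k + 1)) / (of_nat (2 * k + 1) :: complex) powr s)
    \<and> summable (\<lambda>k. of_int (alpha_seq (2 * k + 1)) / (of_nat (2 * k + 1) :: complex) powr s)
    \<and> summable (\<lambda>k. 1 / (of_nat (2 * k + 1) :: complex) powr (2 * s))
    \<and> zeta_M s = (\<Sum>k. (-1) ^ k / of_nat (2 * k + 1) powr s)
    \<and> zeta_M s * zeta_hat_M s = (\<Sum>k. 1 / of_nat (2 * k + 1) powr (2 * s)))
    \<and> summable (\<lambda>k. (-1) ^ k / real (2 * k + 1))
    \<and> summable (\<lambda>k. of_int (alpha_seq (2 * k + 1)) / real (2 * k + 1))
    \<and> summable (\<lambda>k. 1 / real (2 * k + 1) ^ 2)
    \<and> (\<Sum>k. (-1) ^ k / real (2 * k + 1)) * (\<Sum>k. of_int (alpha_seq (2 * k + 1)) / real (2 * k + 1))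
        = (\<Sum>k. 1 / real (2 * k + 1) ^ 2)"
proof (intro conjI allI impI)
  have div: "x / of_nat n powr s = x * of_nat n powr - s" for x s :: complex and n
    by (simp add: powr_minus divide_inverse)
  fix s :: complex assume s: "Re s > 1"
  have M: "(\<lambda>k. of_int (a_seq (2 * k + 1)) / of_nat (2 * k + 1) powr s) sums L_chi s"
    unfolding div by (rule odds_sums[OF L_chi_has_sum[OF s]])
  have H: "(\<lambda>k. of_int (alpha_seq (2 * k + 1)) / of_nat (2 * k + 1) powr s) sums (zeta_odd (2 * s) / L_chi s)"
    unfolding div by (rule odds_sums[OF alpha_seq_dirichlet_series(3)[OF s]])
  have Z: "(\<lambda>k. 1 / of_nat (2 * k + 1) powr (2 * s)) sums zeta_odd (2 * s)"
    unfolding div mult_1 by (rule zeta_odd_sums) (use s in simp)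
  show "summable (\<lambda>k. of_int (a_seq (2 * k + 1)) / (of_nat (2 * k + 1) :: complex) powr s)"
    by (rule sums_summable[OF M])
  show "summable (\<lambda>k. of_int (alpha_seq (2 * k + 1)) / (of_nat (2 * k + 1) :: complex) powr s)"
    by (rule sums_summable[OF H])
  show "summable (\<lambda>k. 1 / (of_nat (2 * k + 1) :: complex) powr (2 * s))"
    by (rule sums_summable[OF Z])
  show "zeta_M s = (\<Sum>k. (-1) ^ k / of_nat (2 * k + 1) powr s)"
    unfolding zeta_M_def a_seq_odd by simp
  show "zeta_M s * zeta_hat_M s = (\<Sum>k. 1 / of_nat (2 * k + 1) powr (2 * s))"
    unfolding zeta_M_def zeta_hat_M_def sums_unique[OF M, symmetric] sums_unique[OF H, symmetric]
      sums_unique[OF Z, symmetric]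
    using alpha_seq_dirichlet_series(2)[OF s] by simp
next
  have H: "(\<lambda>k. complex_of_real (of_int (alpha_seq (2 * k + 1)) / real (2 * k + 1))) sums (zeta_odd 2 / L_chi 1)"
    using alpha_seq_series_at_1 by (simp only: of_real_divide of_real_of_int_eq of_real_of_nat_eq)
  show s: "summable (\<lambda>k. of_int (alpha_seq (2 * k + 1)) / real (2 * k + 1))"
    using sums_summable[OF H] by (simp only: summable_complex_of_real)
  have "complex_of_real (\<Sum>k. of_int (alpha_seq (2 * k + 1)) / real (2 * k + 1)) = zeta_odd 2 / L_chi 1"
    by (rule sums_unique2[OF sums_of_real[OF summable_sums[OF s]] H])
  \<comment> \<open>The value of the second series is the quotient
    \<open>zeta_odd 2 / L_chi 1\<close>; clearing the nonzero denominator gives the product at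
    \<open>1\<close>.\<close>
  hence "L_chi 1 * complex_of_real (\<Sum>k. of_int (alpha_seq (2 * k + 1)) / real (2 * k + 1)) = zeta_odd 2"
    using L_chi_nonzero[of 1] by (simp only: one_complex.sel) simp
  thus "(\<Sum>k. (-1) ^ k / real (2 * k + 1)) * (\<Sum>k. of_int (alpha_seq (2 * k + 1)) / real (2 * k + 1))
        = (\<Sum>k. 1 / real (2 * k + 1) ^ 2)"
    unfolding L_chi_1(2) zeta_odd_2(2) of_real_mult[symmetric] of_real_eq_iff .
qed (use L_chi_1(1) zeta_odd_2(1) in auto)

end
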